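(* For $\lambda \ge 0$ and $t > 0$ put $$f_\lambda(t) := \begin{cases} \dfrac{e^{-\lambda} - e^{-\lambda t}}{\lambda} & \text{for } \lambda \neq 0,\\[2mm] t-1 & \text{for } \lambda = 0.\end{cases}$$ A function $\psi : (0,\infty) \to \mathbb{R}$ is negative definite and increasing if and only if there exist a positive Borel measure $\mu$ on $[0,\infty)$ and a constant $c \in \mathbb{R}$ such that $$\psi(t) = c + \int_{[0,\infty)} f_\lambda(t)\, d\mu(\lambda) \qquad \text{for all } t > 0.\qquad ( * )$$ In this case $c = \psi(1)$ and $\mu$ is uniquely determined by $\psi' = \mathcal{L}(\mu)$ on $(0,\infty)$. Moreover, a positive Borel measure $\mu$ on $[0,\infty)$ occurs in a representation $( * )$ of some such $\psi$ if and only if its Laplace transform $\mathcal{L}(\mu)(t)$ is finite for every $t\in(0,\infty)$.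
   Context: A function $f : (0,\infty) \to \mathbb{R}$ is called negative definite if the kernel $Q(x,y) = f\big(\frac{x+y}{2}\big)$ on $(0,\infty)\times(0,\infty)$ is negative definite, i.e. $\sum_{j,k=1}^n c_j \overline{c_k}\, Q(x_j,x_k) \le 0$ for all $n$, all $x_1,\dots,x_n \in (0,\infty)$ and all $c_1,\dots,c_n \in \mathbb{C}$ with $\sum_j c_j = 0$. "Increasing" means $\psi(s) \le \psi(t)$ for $s \le t$. The Laplace transform of a positive Borel measure $\mu$ on $[0,\infty)$ is $\mathcal{L}(\mu)(t) = \int_{[0,\infty)} e^{-\lambda t}\, d\mu(\lambda) \in [0,\infty]$. *)

theory Defs
  imports "HOL-Analysis.Analysis" "HOL-Library.Complex_Order"
begin

text \<open>
  With the order of \<^theory>\<open>HOL-Library.Complex_Order\<close>, \<open>z \<le> 0\<close> means that the complex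
  number \<open>z\<close> is real and nonpositive. The points \<open>x j\<close> need not be distinct.
\<close>

definition neg_def_kernel :: "'a set \<Rightarrow> ('a \<Rightarrow> 'a \<Rightarrow> complex) \<Rightarrow> bool" where
  "neg_def_kernel S Q \<longleftrightarrow>
     (\<forall>(n::nat) (x :: nat \<Rightarrow> 'a) (c :: nat \<Rightarrow> complex).
        (\<forall>j<n. x j \<in> S) \<and> (\<Sum>j<n. c j) = 0 \<longrightarrow>
        (\<Sum>j<n. \<Sum>k<n. c j * cnj (c k) * Q (x j) (x k)) \<le> 0)"

text \<open>
  Functions on \<open>(0,\<infinity>)\<close> are represented by functions on all of \<open>\<real>\<close> whose values
  outside \<open>(0,\<infinity>)\<close> are irrelevant.
\<close>

definition neg_def_fun :: "(real \<Rightarrow> real) \<Rightarrow> bool" where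
  "neg_def_fun f \<longleftrightarrow> neg_def_kernel {0<..} (\<lambda>x y. complex_of_real (f ((x + y) / 2)))"

text \<open>
  Measures on the Borel sigma-algebra of the subspace \<open>[0,\<infinity>)\<close>; in particular
  \<open>space \<mu> = {0..}\<close>, and neither finiteness nor sigma-finiteness is assumed.
\<close>

definition borel_measure_nonneg :: "real measure \<Rightarrow> bool" where
  "borel_measure_nonneg \<mu> \<longleftrightarrow> sets \<mu> = sets (restrict_space borel {0::real..})"

definition laplace :: "real measure \<Rightarrow> real \<Rightarrow> ennreal" where
  "laplace \<mu> t = (\<integral>\<^sup>+ l. ennreal (exp (- (l * t))) \<partial>\<mu>)"

definition f_levy :: "real \<Rightarrow> real \<Rightarrow> real" where
  "f_levy l t = (if l \<noteq> 0 then (exp (- l) - exp (- (l * t))) / l else t - 1)"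

text \<open>
  Integrability is required explicitly, since the Bochner integral of a non-integrable
  function is \<open>0\<close> by convention. For fixed \<open>t\<close> the integrand has constant sign, so this
  says exactly that its integral, which exists in \<open>[-\<infinity>,\<infinity>]\<close>, is finite.
\<close>

definition levy_representation :: "(real \<Rightarrow> real) \<Rightarrow> real \<Rightarrow> real measure \<Rightarrow> bool" where
  "levy_representation \<psi> c \<mu> \<longleftrightarrow>
     (\<forall>t>0. integrable \<mu> (\<lambda>l. f_levy l t) \<and> \<psi> t = c + (\<integral>l. f_levy l t \<partial>\<mu>))"

text \<open>
  \<open>\<psi>' = \<L>(\<mu>)\<close> on \<open>(0,\<infinity>)\<close>. Finiteness is explicit because \<^const>\<open>enn2real\<close> maps \<open>\<infinity>\<close> to \<open>0\<close>.
\<close>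

definition deriv_eq_laplace :: "(real \<Rightarrow> real) \<Rightarrow> real measure \<Rightarrow> bool" where
  "deriv_eq_laplace \<psi> \<mu> \<longleftrightarrow>
     (\<forall>t>0. laplace \<mu> t < \<infinity> \<and> (\<psi> has_real_derivative enn2real (laplace \<mu> t)) (at t))"

end

(*
  Let \<psi> be negative definite and increasing, and let u be its restriction to an arithmetic
  progression. Negative definiteness makes the even differences of u nonpositive. Since u is
  increasing, each even difference is a bounded convex sequence, so the odd differences are
  nonnegative, and the increments of u form a completely monotone sequence. By Hausdorff, the
  unit increments \<psi>(t + 1) - \<psi>(t) on the progression of step 2^-k are the moments of a measure
  on [0,1]. Uniqueness of moments makes these measures, after the substitution y = x^(2^k), agree
  for all k up to an explicit density. The substitution y = exp(-l) turns the common measure into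
  \<mu>, whose integral of f_levy has the same unit increments as \<psi> at dyadic points. That determines
  \<psi> up to an additive constant, because the increments of both functions decrease.
  The derivative comes from the bounds (s - t) exp(-l s) \<le> f_levy l s - f_levy l t \<le> (s - t) exp(-l t).
*)

theory Submission
  imports Defs "HOL-Probability.Probability" "HOL-Real_Asymp.Real_Asymp"
begin

subsection \<open>Real quadratic forms\<close>

text \<open>Symmetry of \<open>K\<close> cancels the mixed products of real and imaginary parts, so
  complex coefficients contribute two separate real quadratic forms.\<close>

lemma hermitian_form_real_kernel:
  fixes K :: "nat \<Rightarrow> nat \<Rightarrow> real" and c :: "nat \<Rightarrow> complex"
  assumes "\<And>j k. K j k = K k j"
  shows "(\<Sum>j<n. \<Sum>k<n. c j * cnj (c k) * complex_of_real (K j k)) =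
    complex_of_real ((\<Sum>j<n. \<Sum>k<n. Re (c j) * Re (c k) * K j k) +
                     (\<Sum>j<n. \<Sum>k<n. Im (c j) * Im (c k) * K j k))"
proof -
  have "(\<Sum>j<n. \<Sum>k<n. Re (c j) * Im (c k) * K j k) = (\<Sum>j<n. \<Sum>k<n. Im (c j) * Re (c k) * K j k)"
    by (subst sum.swap) (simp add: assms mult.commute)
  then show ?thesis
    by (simp add: complex_eq_iff algebra_simps sum.distrib sum_subtractf)
qed

text \<open>Real and imaginary parts of coefficients with sum zero again have sum zero, so real
  coefficients suffice to test negative definiteness.\<close>

lemma neg_def_fun_iff_real:
  "neg_def_fun f \<longleftrightarrow>
    (\<forall>(n::nat) (x :: nat \<Rightarrow> real) (a :: nat \<Rightarrow> real). (\<forall>j<n. 0 < x j) \<and> (\<Sum>j<n. a j) = 0 \<longrightarrow>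
       (\<Sum>j<n. \<Sum>k<n. a j * a k * f ((x j + x k) / 2)) \<le> 0)"
proof -
  have form: "(\<Sum>j<n. \<Sum>k<n. c j * cnj (c k) * complex_of_real (f ((x j + x k) / 2))) =
      complex_of_real ((\<Sum>j<n. \<Sum>k<n. Re (c j) * Re (c k) * f ((x j + x k) / 2)) +
                       (\<Sum>j<n. \<Sum>k<n. Im (c j) * Im (c k) * f ((x j + x k) / 2)))" for n c and x :: "nat \<Rightarrow> real"
    by (rule hermitian_form_real_kernel[of "\<lambda>j k. f ((x j + x k) / 2)"]) (simp add: add.commute)
  show ?thesis
    unfolding neg_def_fun_def neg_def_kernel_def form
  proof (intro iffI allI impI, goal_cases)
    case (1 n x a)
    then show ?case
      using 1(1)[rule_format, of n x "\<lambda>j. complex_of_real (a j)"]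
      by (simp flip: of_real_sum add: less_eq_complex_def)
  next
    case (2 n x c)
    from 2(2) have "(\<Sum>j<n. Re (c j)) = 0" "(\<Sum>j<n. Im (c j)) = 0"
      by (simp_all flip: Re_sum Im_sum)
    with 2 show ?case
      by (simp add: less_eq_complex_def add_nonpos_nonpos)
  qed
qed

subsection \<open>Completely monotone sequences\<close>

text \<open>This is \<open>(- 1) ^ m\<close> times the m-th forward difference; with this sign the
  powers \<open>x ^ n\<close> are sent to \<open>x ^ n * (1 - x) ^ m\<close>.\<close>

fun bdiff :: "(nat \<Rightarrow> real) \<Rightarrow> nat \<Rightarrow> nat \<Rightarrow> real" where
  "bdiff u 0 n = u n"
| "bdiff u (Suc m) n = bdiff u m n - bdiff u m (Suc n)"

definition completely_monotone_seq :: "(nat \<Rightarrow> real) \<Rightarrow> bool" where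
  "completely_monotone_seq u \<longleftrightarrow> (\<forall>m n. 0 \<le> bdiff u m n)"

lemma sum_binomial_Suc:
  fixes g :: "nat \<Rightarrow> real"
  shows "(\<Sum>j\<le>Suc M. of_nat (Suc M choose j) * g j) =
    (\<Sum>j\<le>M. of_nat (M choose j) * g j) + (\<Sum>j\<le>M. of_nat (M choose j) * g (Suc j))"
proof -
  have "(\<Sum>j\<le>M. real (M choose j) * g j) = (\<Sum>j\<le>Suc M. real (M choose j) * g j)"
    by simp
  also have "\<dots> = g 0 + (\<Sum>j\<le>M. real (M choose Suc j) * g (Suc j))"
    by (simp add: sum.atMost_Suc_shift del: sum.atMost_Suc)
  finally show ?thesis
    by (simp add: sum.atMost_Suc_shift ring_distribs sum.distrib del: sum.atMost_Suc)
qed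

lemma bdiff_binomial:
  "bdiff u m n = (\<Sum>j\<le>m. of_nat (m choose j) * ((- 1) ^ j * u (n + j)))"
proof (induction m arbitrary: n)
  case (Suc m)
  show ?case
    unfolding sum_binomial_Suc by (simp add: Suc sum_negf)
qed simp

lemma bdiff_bdiff: "bdiff (bdiff u p) q n = bdiff u (p + q) n"
  by (induction q arbitrary: n) simp_all

lemma bdiff_forward_difference: "bdiff (\<lambda>n. u (Suc n) - u n) m n = - bdiff u (Suc m) n"
  by (induction m arbitrary: n) simp_all

lemma bdiff_sum_shift: "bdiff (\<lambda>n. \<Sum>i\<in>I. v (n + i)) m n = (\<Sum>i\<in>I. bdiff v m (n + i))"
  by (induction m arbitrary: n) (simp_all add: sum_subtractf)

lemma completely_monotone_seq_sum_shift:
  "completely_monotone_seq v \<Longrightarrow> completely_monotone_seq (\<lambda>n. \<Sum>i\<in>I. v (n + i))"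
  by (simp add: completely_monotone_seq_def bdiff_sum_shift sum_nonneg)

lemma completely_monotone_seq_nonneg: "completely_monotone_seq u \<Longrightarrow> 0 \<le> u n"
  unfolding completely_monotone_seq_def by (metis bdiff.simps(1))

lemma completely_monotone_seq_decseq:
  assumes "completely_monotone_seq u" shows "decseq u"
proof (rule decseq_SucI)
  show "u (Suc n) \<le> u n" for n
    using assms[unfolded completely_monotone_seq_def, rule_format, of "Suc 0" n] by simp
qed

text \<open>By convexity a positive increment persists, so the sequence would grow at least linearly
  and pass \<open>B\<close>.\<close>

lemma convex_bounded_seq_antimono:
  fixes w :: "nat \<Rightarrow> real"
  assumes convex: "\<And>n. w (Suc n) - w n \<le> w (Suc (Suc n)) - w (Suc n)" and bounded: "\<And>n. w n \<le> B"
  shows "w (Suc n) \<le> w n"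
proof (rule ccontr)
  assume "\<not> w (Suc n) \<le> w n"
  then have d: "0 < w (Suc n) - w n" by simp
  have slope: "w (Suc n) - w n \<le> w (Suc (n + k)) - w (n + k)" for k
  proof (induction k)
    case (Suc k)
    then show ?case using convex[of "n + k"] by simp
  qed simp
  have growth: "w n + real k * (w (Suc n) - w n) \<le> w (n + k)" for k
  proof (induction k)
    case (Suc k)
    then show ?case using slope[of k] by (simp add: algebra_simps)
  qed simp
  obtain k where "B - w n < real k * (w (Suc n) - w n)"
    using reals_Archimedean3[OF d] by blast
  then show False using growth[of k] bounded[of "n + k"] by linarith
qed

text \<open>
  The even differences have a fixed sign by hypothesis. Each of them is convex and bounded,
  hence monotone, which gives the sign of the next odd difference.
\<close>

lemma completely_monotone_seq_increments:
  assumes inc: "\<And>n. u n \<le> u (Suc n)" and even: "\<And>p n. 1 \<le> p \<Longrightarrow> bdiff u (2 * p) n \<le> 0"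
  shows "completely_monotone_seq (\<lambda>n. u (Suc n) - u n)"
proof -
  have odd: "bdiff u (2 * q + 1) n \<le> 0" for q n
  proof (induction q arbitrary: n)
    case 0
    then show ?case using inc by simp
  next
    case (Suc q)
    define b where "b n = - bdiff u (2 * q + 1) n" for n
    define w where "w n = - bdiff u (2 * q + 2) n" for n
    have b_nonneg: "0 \<le> b n" for n using Suc by (simp add: b_def)
    have w_nonneg: "0 \<le> w n" for n using even[of "Suc q" n] by (simp add: w_def)
    have w_b: "w n = b n - b (Suc n)" for n by (simp add: w_def b_def)
    have "decseq b" by (rule decseq_SucI) (use w_b w_nonneg in \<open>metis diff_ge_0_iff_ge\<close>)
    then have "b n \<le> b 0" for n by (simp add: decseqD)
    then have "w n \<le> b 0" for n using w_b[of n] b_nonneg[of "Suc n"] by (smt (verit))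
    \<comment> \<open>Convexity of \<open>w\<close> is the sign of the even difference of order
      \<open>2 * q + 4\<close>.\<close>
    moreover have "w (Suc n) - w n \<le> w (Suc (Suc n)) - w (Suc n)" for n
      using even[of "Suc (Suc q)" n] by (simp add: w_def)
    ultimately have "w (Suc n) \<le> w n" by (rule convex_bounded_seq_antimono[rotated])
    then show ?case by (simp add: w_def)
  qed
  have "bdiff u (Suc m) n \<le> 0" for m n
  proof (cases "even (Suc m)")
    case True
    then obtain p where "Suc m = 2 * p" by (elim evenE)
    then show ?thesis using even[of p n] by (cases p) auto
  next
    case False
    then obtain q where "Suc m = 2 * q + 1" by (elim oddE)
    then show ?thesis using odd[of q n] by simp
  qed
  then show ?thesis
    unfolding completely_monotone_seq_def bdiff_forward_difference by simp
qed

text \<open>With test points spaced by \<open>2 * h\<close>, all midpoints lie on the progression of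
  step \<open>h\<close>, and that of \<open>x j\<close> and \<open>x k\<close> has index
  \<open>n + j + k\<close>. Signed binomial coefficients, whose sum vanishes for
  \<open>1 \<le> p\<close>, turn the quadratic form into a p-th difference of a p-th
  difference.\<close>

lemma neg_def_fun_bdiff:
  assumes "neg_def_fun \<psi>" "0 < t" "0 \<le> h" "1 \<le> p"
  shows "bdiff (\<lambda>n. \<psi> (t + real n * h)) (2 * p) n \<le> 0"
proof -
  define u where "u n = \<psi> (t + real n * h)" for n
  define a where "a j = real (p choose j) * (- 1) ^ j" for j
  define x where "x j = t + real n * h + 2 * real j * h" for j
  have "(\<Sum>j<Suc p. a j) = 0"
    using choose_alternating_sum[of p, where 'a=real] assms(4)
    unfolding lessThan_Suc_atMost a_def by (simp add: mult.commute)
  moreover have "0 < x j" for j using assms by (simp add: x_def add_pos_nonneg)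
  ultimately have "(\<Sum>j<Suc p. \<Sum>k<Suc p. a j * a k * \<psi> ((x j + x k) / 2)) \<le> 0"
    using assms(1) unfolding neg_def_fun_iff_real by blast
  moreover have "\<psi> ((x j + x k) / 2) = u (n + j + k)" for j k
    unfolding u_def x_def by (rule arg_cong[of _ _ \<psi>]) (simp add: field_simps)
  ultimately have "(\<Sum>j<Suc p. \<Sum>k<Suc p. a j * a k * u (n + j + k)) \<le> 0"
    by simp
  also have "(\<Sum>j<Suc p. \<Sum>k<Suc p. a j * a k * u (n + j + k)) = bdiff (bdiff u p) p n"
    unfolding lessThan_Suc_atMost a_def bdiff_binomial[of "bdiff u p"] bdiff_binomial[of u]
    by (simp add: sum_distrib_left mult_ac)
  finally show ?thesis by (simp add: bdiff_bdiff u_def[abs_def] mult_2)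
qed

lemma neg_def_increasing_increments:
  assumes "neg_def_fun \<psi>" "mono_on {0<..} \<psi>" "0 < t" "0 \<le> h"
  shows "completely_monotone_seq (\<lambda>n. \<psi> (t + real (Suc n) * h) - \<psi> (t + real n * h))"
proof (rule completely_monotone_seq_increments[of "\<lambda>n. \<psi> (t + real n * h)"])
  show "\<psi> (t + real n * h) \<le> \<psi> (t + real (Suc n) * h)" for n
    by (rule mono_onD[OF assms(2)]) (use assms in \<open>auto simp: add_pos_nonneg distrib_right\<close>)
qed (rule neg_def_fun_bdiff[OF assms(1,3,4)])

text \<open>A unit step splits into \<open>2 ^ k\<close> steps of length \<open>1 / 2 ^ k\<close>,
  so the unit increment is a sum of shifts of a completely monotone sequence.\<close>

lemma neg_def_increasing_unit_increments:
  assumes "neg_def_fun \<psi>" "mono_on {0<..} \<psi>" "0 < t"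
  shows "completely_monotone_seq (\<lambda>n. \<psi> (t + real n / 2 ^ k + 1) - \<psi> (t + real n / 2 ^ k))"
proof -
  have telescope: "(\<Sum>i<(2::nat) ^ k. \<psi> (t + real (Suc (n + i)) * (1 / 2 ^ k)) - \<psi> (t + real (n + i) * (1 / 2 ^ k)))
      = \<psi> (t + real n / 2 ^ k + 1) - \<psi> (t + real n / 2 ^ k)" for n
    using sum_lessThan_telescope[of "\<lambda>i. \<psi> (t + real (n + i) * (1 / 2 ^ k))" "2 ^ k"]
    by (simp add: add_divide_distrib add_ac)
  show ?thesis
    using completely_monotone_seq_sum_shift[OF neg_def_increasing_increments[OF assms, of "1 / 2 ^ k"],
        of "{..<2 ^ k}"]
    by (simp only: telescope) simp
qed

subsection \<open>The Hausdorff moment problem\<close>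

text \<open>The splitting of \<open>bdiff u m n\<close> into \<open>bdiff u (Suc m) n\<close> and
  \<open>bdiff u m (Suc n)\<close> is repeated \<open>M\<close> times. For moments this multiplies
  \<open>x ^ n * (1 - x) ^ m\<close> by \<open>(x + (1 - x)) ^ M\<close>.\<close>

lemma sum_binomial_bdiff:
  "(\<Sum>j\<le>M. of_nat (M choose j) * bdiff u (m + (M - j)) (n + j)) = bdiff u m n"
proof (induction M arbitrary: m n)
  case (Suc M)
  have "(\<Sum>j\<le>M. of_nat (M choose j) * bdiff u (m + (Suc M - j)) (n + j)) = bdiff u (Suc m) n"
    by (rule trans[OF _ Suc[of "Suc m" n]], rule sum.cong) (auto simp: Suc_diff_le)
  moreover have "(\<Sum>j\<le>M. of_nat (M choose j) * bdiff u (m + (Suc M - Suc j)) (n + Suc j)) = bdiff u m (Suc n)"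
    using Suc[of m "Suc n"] by simp
  ultimately show ?case unfolding sum_binomial_Suc by simp
qed simp

text \<open>
  The value of the functional with moments \<open>a\<close> at the Bernstein basis polynomial of
  degree \<open>N\<close> and index \<open>k\<close>.
\<close>

definition bernstein_weight :: "(nat \<Rightarrow> real) \<Rightarrow> nat \<Rightarrow> nat \<Rightarrow> real" where
  "bernstein_weight a N k = of_nat (N choose k) * bdiff a (N - k) k"

lemma bernstein_weight_nonneg: "completely_monotone_seq a \<Longrightarrow> 0 \<le> bernstein_weight a N k"
  by (simp add: bernstein_weight_def completely_monotone_seq_def)

text \<open>In the Bernstein basis of degree \<open>N\<close> the monomial of degree
  \<open>p\<close> has the coefficients \<open>(k choose p) / (N choose p)\<close>; the functional
  is applied to this expansion. For \<open>p = 0\<close> it says that the total weight is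
  \<open>a 0\<close>.\<close>

lemma bernstein_weight_factorial_moment:
  assumes "p \<le> N"
  shows "(\<Sum>k\<le>N. bernstein_weight a N k * (of_nat (k choose p) / of_nat (N choose p))) = a p"
proof -
  have "(\<Sum>k\<le>N. bernstein_weight a N k * (of_nat (k choose p) / of_nat (N choose p))) =
      (\<Sum>k\<in>{p..N}. bernstein_weight a N k * (of_nat (k choose p) / of_nat (N choose p)))"
    by (rule sum.mono_neutral_right) auto
  also have "\<dots> = (\<Sum>k\<in>{p..N}. of_nat ((N - p) choose (k - p)) * bdiff a (N - k) k)"
  proof (rule sum.cong)
    fix k assume "k \<in> {p..N}"
    then have "real (N choose k) * real (k choose p) = real (N choose p) * real ((N - p) choose (k - p))"
      by (simp add: choose_mult flip: of_nat_mult)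
    moreover have "N choose p > 0" using assms by simp
    ultimately show "bernstein_weight a N k * (of_nat (k choose p) / of_nat (N choose p)) =
        of_nat ((N - p) choose (k - p)) * bdiff a (N - k) k"
      by (simp add: bernstein_weight_def field_simps)
  qed simp
  also have "\<dots> = (\<Sum>j\<le>N - p. of_nat ((N - p) choose j) * bdiff a (0 + (N - p - j)) (p + j))"
    by (rule sum.reindex_bij_witness[of _ "\<lambda>j. p + j" "\<lambda>k. k - p"]) (use assms in auto)
  also have "\<dots> = a p"
    unfolding sum_binomial_bdiff by simp
  finally show ?thesis .
qed

text \<open>Both terms are products of \<open>p\<close> factors in [0,1], so their difference is at
  most the sum of the differences of the factors.\<close>

lemma power_binomial_ratio_bound:
  assumes "k \<le> N" "p < N"
  shows "\<bar>(real k / real N) ^ p - real (k choose p) / real (N choose p)\<bar> \<le> real p * (real p / real (N - p))"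
proof -
  have N: "N choose p = (\<Prod>i<p. real (N - i) / real (p - i))"
    using binomial_altdef_of_nat[of p N, where 'a=real] assms by (simp add: atLeast0LessThan)
  have k: "real (k choose p) = (\<Prod>i<p. real (k - i) / real (p - i))"
  proof (cases "p \<le> k")
    case True
    then show ?thesis
      using binomial_altdef_of_nat[of p k, where 'a=real] by (simp add: atLeast0LessThan)
  next
    case False
    then have "(\<Prod>i<p. real (k - i) / real (p - i)) = 0"
      by (intro prod_zero bexI[of _ k]) auto
    moreover have "real (k choose p) = 0" using False by (simp add: binomial_eq_0)
    ultimately show ?thesis by (simp only:)
  qed
  have ratio: "real (k choose p) / real (N choose p) = (\<Prod>i<p. real (k - i) / real (N - i))"
    unfolding N k prod_dividef[symmetric] by (rule prod.cong) auto
  have "\<bar>(\<Prod>i<p. real k / real N) - (\<Prod>i<p. real (k - i) / real (N - i))\<bar>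
      \<le> (\<Sum>i<p. \<bar>real k / real N - real (k - i) / real (N - i)\<bar>)"
    using norm_prod_diff[of "{..<p}" "\<lambda>_. real k / real N" "\<lambda>i. real (k - i) / real (N - i)"] assms
    by (auto simp: divide_le_eq_1)
  also have "\<dots> \<le> (\<Sum>i<p. real p / real (N - p))"
  proof (rule sum_mono)
    fix i assume "i \<in> {..<p}"
    then have i: "i < p" by simp
    show "\<bar>real k / real N - real (k - i) / real (N - i)\<bar> \<le> real p / real (N - p)"
    proof (cases "i \<le> k")
      case True
      have "real k / real N - real (k - i) / real (N - i) = real i * (real N - real k) / (real N * real (N - i))"
        using True i assms by (simp add: field_simps of_nat_diff)
      moreover have "real i * (real N - real k) / (real N * real (N - i)) \<le> real p * real N / (real N * real (N - p))"
        using i assms by (intro frac_le mult_mono) (auto intro!: mult_pos_pos)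
      ultimately show ?thesis using i assms by simp
    next
      \<comment> \<open>Truncated subtraction makes \<open>k - i\<close> zero here, and
        \<open>k < i < p\<close> bounds the other quotient.\<close>
      case False
      then have "real k / real N \<le> real p / real (N - p)"
        using i assms by (intro frac_le) auto
      then show ?thesis using False by simp
    qed
  qed
  finally show ?thesis by (simp add: ratio)
qed

text \<open>Replacing \<open>(k choose p) / (N choose p)\<close> by \<open>(k / N) ^ p\<close>
  disturbs the exact moment identity by an error of order 1/N times the total weight
  \<open>a 0\<close>. The shift to \<open>Suc N\<close> avoids a division by zero.\<close>

lemma bernstein_moment_limit:
  assumes "completely_monotone_seq a"
  shows "(\<lambda>N. \<Sum>k\<le>Suc N. bernstein_weight a (Suc N) k * (real k / real (Suc N)) ^ p) \<longlonglongrightarrow> a p"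
proof (rule Lim_transform2[OF tendsto_const])
  have "(\<lambda>N. real p * (real p / real (Suc N - p)) * a 0) \<longlonglongrightarrow> 0"
    by (real_asymp)
  moreover have "\<forall>\<^sub>F N in sequentially.
      norm (a p - (\<Sum>k\<le>Suc N. bernstein_weight a (Suc N) k * (real k / real (Suc N)) ^ p))
        \<le> real p * (real p / real (Suc N - p)) * a 0"
    using eventually_ge_at_top[of p]
  proof eventually_elim
    case (elim N)
    let ?w = "bernstein_weight a (Suc N)" and ?r = "\<lambda>k. real (k choose p) / real (Suc N choose p)"
    have "norm (a p - (\<Sum>k\<le>Suc N. ?w k * (real k / real (Suc N)) ^ p))
        = \<bar>\<Sum>k\<le>Suc N. ?w k * ((real k / real (Suc N)) ^ p - ?r k)\<bar>"
      using bernstein_weight_factorial_moment[of p "Suc N" a] elim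
      by (simp add: right_diff_distrib sum_subtractf del: sum.atMost_Suc)
    also have "\<dots> \<le> (\<Sum>k\<le>Suc N. ?w k * (real p * (real p / real (Suc N - p))))"
    proof (intro order.trans[OF sum_abs] sum_mono)
      fix k assume "k \<in> {..Suc N}"
      then have "\<bar>(real k / real (Suc N)) ^ p - ?r k\<bar> \<le> real p * (real p / real (Suc N - p))"
        using elim by (intro power_binomial_ratio_bound) auto
      then show "\<bar>?w k * ((real k / real (Suc N)) ^ p - ?r k)\<bar> \<le> ?w k * (real p * (real p / real (Suc N - p)))"
        unfolding abs_mult abs_of_nonneg[OF bernstein_weight_nonneg[OF assms]]
        by (rule mult_left_mono) (rule bernstein_weight_nonneg[OF assms])
    qed
    also have "\<dots> = real p * (real p / real (Suc N - p)) * a 0"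
      using bernstein_weight_factorial_moment[of 0 "Suc N" a] unfolding sum_distrib_right[symmetric]
      by (simp del: sum.atMost_Suc)
    finally show ?case .
  qed
  ultimately show "(\<lambda>N. a p - (\<Sum>k\<le>Suc N. bernstein_weight a (Suc N) k * (real k / real (Suc N)) ^ p)) \<longlonglongrightarrow> 0"
    by (rule Lim_null_comparison[rotated])
qed

text \<open>The Bernstein weights of degree \<open>Suc N\<close>, placed at the points
  \<open>k / Suc N\<close>, form probability measures on [0,1]. They are tight, and a weak limit of
  a subsequence inherits the limits of their moments.\<close>

lemma hausdorff_moment_normalized:
  assumes cm: "completely_monotone_seq a" and a0: "a 0 = 1"
  obtains M where "real_distribution M" "AE x in M. 0 \<le> x \<and> x \<le> 1" "\<And>n. (\<integral>x. x ^ n \<partial>M) = a n"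
proof -
  define P where "P N = point_measure {..Suc N} (bernstein_weight a (Suc N))" for N
  define X where "X N k = real k / real (Suc N)" for N k :: nat
  define M where "M N = distr (P N) borel (X N)" for N
  have X[measurable]: "X N \<in> borel_measurable (P N)" for N
    by (simp add: P_def point_measure_def)
  have X01: "AE k in P N. 0 \<le> X N k \<and> X N k \<le> 1" for N
    by (rule AE_I2) (simp add: P_def space_point_measure X_def)
  have "(\<Sum>k\<le>Suc N. bernstein_weight a (Suc N) k) = 1" for N
    using bernstein_weight_factorial_moment[of 0 "Suc N" a] a0 by simp
  then have "prob_space (P N)" for N
    using bernstein_weight_nonneg[OF cm]
    by (intro prob_spaceI)
       (simp add: P_def space_point_measure emeasure_point_measure_finite del: sum.atMost_Suc)
  then have dist: "real_distribution (M N)" for N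
    unfolding M_def by (intro prob_space.real_distribution_distr) auto
  have "tight M"
    unfolding tight_def
  proof (intro conjI allI impI, rule dist, rule exI[of _ "-1"], rule exI[of _ 1], intro conjI allI)
    fix e :: real and N assume "0 < e"
    interpret real_distribution "M N" by (rule dist)
    have "AE x in M N. x \<in> {-1<..1}"
      unfolding M_def by (subst AE_distr_iff) (auto intro!: eventually_mono[OF X01[of N]])
    then have "prob {-1<..1} = 1" by (subst prob_eq_1) auto
    then show "1 - e < prob {-1<..1}" using \<open>0 < e\<close> by simp
  qed simp
  then obtain r L where r: "strict_mono (r :: nat \<Rightarrow> nat)" and L: "real_distribution L"
    and conv: "weak_conv_m (M \<circ> id \<circ> r) L"
    using tight_imp_convergent_subsubsequence[of M id] strict_mono_id by blast
  interpret L: real_distribution L by (rule L)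
  \<comment> \<open>Clamping to [0,1] makes the powers bounded and continuous on the whole line, as
    weak convergence demands.\<close>
  define cl where "cl x = max 0 (min 1 x)" for x :: real
  have cl_cont: "continuous_on UNIV cl" unfolding cl_def by (intro continuous_intros)
  then have [measurable]: "cl \<in> borel_measurable borel" by (rule borel_measurable_continuous_onI)
  have cl01: "0 \<le> cl x" "cl x \<le> 1" for x by (simp_all add: cl_def)
  have moment: "(\<integral>x. cl x ^ p \<partial>L) = a p" for p
  proof (rule LIMSEQ_unique)
    show "(\<lambda>n. \<integral>x. cl x ^ p \<partial>(M \<circ> id \<circ> r) n) \<longlonglongrightarrow> (\<integral>x. cl x ^ p \<partial>L)"
      by (rule weak_conv_imp_integral_bdd_continuous_conv[where B = 1])
         (use cl_cont cl01 dist L conv in \<open>auto simp: o_def continuous_on_eq_continuous_at power_le_one\<close>)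
    have "(\<integral>x. cl x ^ p \<partial>M N) = (\<Sum>k\<le>Suc N. bernstein_weight a (Suc N) k * (real k / real (Suc N)) ^ p)" for N
    proof -
      have "(\<integral>x. cl x ^ p \<partial>M N) = (\<integral>k. cl (X N k) ^ p \<partial>P N)"
        unfolding M_def by (rule integral_distr) auto
      also have "\<dots> = (\<integral>k. X N k ^ p \<partial>P N)"
        by (rule integral_cong_AE) (auto intro!: eventually_mono[OF X01[of N]] simp: cl_def)
      also have "\<dots> = (\<Sum>k\<le>Suc N. bernstein_weight a (Suc N) k * X N k ^ p)"
        unfolding P_def by (subst lebesgue_integral_point_measure_finite)
          (auto simp: bernstein_weight_nonneg[OF cm] simp del: sum.atMost_Suc)
      finally show ?thesis by (simp only: X_def)
    qed
    then have "(\<lambda>N. \<integral>x. cl x ^ p \<partial>M N) \<longlonglongrightarrow> a p"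
      using bernstein_moment_limit[OF cm] by simp
    then show "(\<lambda>n. \<integral>x. cl x ^ p \<partial>(M \<circ> id \<circ> r) n) \<longlonglongrightarrow> a p"
      using LIMSEQ_subseq_LIMSEQ[OF _ r] by (simp add: o_def)
  qed
  show ?thesis
  proof (rule that)
    \<comment> \<open>The witness is the image of \<open>L\<close> under \<open>cl\<close>, which is
      carried by [0,1] by construction.\<close>
    show "real_distribution (distr L borel cl)"
      by (rule L.real_distribution_distr) auto
    show "AE x in distr L borel cl. 0 \<le> x \<and> x \<le> 1"
      by (subst AE_distr_iff) (auto simp: cl01)
    show "(\<integral>x. x ^ n \<partial>distr L borel cl) = a n" for n
      by (subst integral_distr) (auto simp: moment)
  qed
qed

section \<open>Finite measures on [0,1] and their moments\<close>

lemma bdiff_scale: "bdiff (\<lambda>n. c * u n) m n = c * bdiff u m n"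
  by (induction m arbitrary: n) (simp_all add: algebra_simps)

lemma unit_interval_power_integrable:
  assumes "finite_measure M" "sets M = sets borel" "AE x in M. 0 \<le> x \<and> x \<le> (1::real)"
  shows "integrable M (\<lambda>x. x ^ n)"
proof -
  interpret finite_measure M by fact
  note assms(2)[measurable_cong]
  show ?thesis
    by (rule integrable_const_bound[where B = 1, OF eventually_mono[OF assms(3)]]) (auto simp: power_le_one)
qed

text \<open>Division by \<open>a 0\<close> reduces to the normalized case, and a constant density
  restores the mass. If \<open>a 0\<close> is 0, the decreasing nonnegative sequence is
  zero.\<close>

theorem hausdorff_moment:
  assumes "completely_monotone_seq a"
  obtains M where "finite_measure M" "sets M = sets borel" "AE x in M. 0 \<le> x \<and> x \<le> 1"
    "\<And>n. has_bochner_integral M (\<lambda>x. x ^ n) (a n)"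
proof (cases "a 0 = 0")
  case True
  have "a n = 0" for n
    using completely_monotone_seq_nonneg[OF assms, of n] True
      decseqD[OF completely_monotone_seq_decseq[OF assms], of 0 n] by simp
  moreover have "AE x in null_measure (borel :: real measure). 0 \<le> x \<and> x \<le> 1"
    by (rule AE_I[of _ _ UNIV]) auto
  ultimately show ?thesis
    by (intro that[of "null_measure borel"])
       (simp_all add: has_bochner_integral_iff integrable_iff_bounded finite_measureI)
next
  case False
  then have a0: "0 < a 0" using completely_monotone_seq_nonneg[OF assms, of 0] by simp
  have "completely_monotone_seq (\<lambda>n. inverse (a 0) * a n)"
    using assms a0 by (simp add: completely_monotone_seq_def bdiff_scale)
  then obtain M where M: "real_distribution M" "AE x in M. 0 \<le> x \<and> x \<le> 1"
    "\<And>n. (\<integral>x. x ^ n \<partial>M) = inverse (a 0) * a n"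
    by (rule hausdorff_moment_normalized) (use a0 in auto)
  interpret real_distribution M by fact
  have *: "has_bochner_integral (density M (\<lambda>_. ennreal (a 0))) (\<lambda>x. x ^ n) (a n)" for n
  proof (rule has_bochner_integral_density)
    show "has_bochner_integral M (\<lambda>x. a 0 *\<^sub>R x ^ n) (a n)"
      using unit_interval_power_integrable[OF finite_measure_axioms _ M(2), of n] M(3)[of n] a0
      by (auto simp: has_bochner_integral_iff)
  qed (use a0 in auto)
  show ?thesis
  proof (rule that[OF _ _ _ *])
    show "finite_measure (density M (\<lambda>_. ennreal (a 0)))"
      by (rule finite_measureI) (simp add: emeasure_density_const emeasure_space_1 ennreal_mult_eq_top_iff)
  qed (use M(2) a0 in \<open>auto simp: AE_density elim: eventually_mono\<close>)
qed

text \<open>Moments of a distribution on [0,1] are at most 1, so the Taylor series of its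
  characteristic function converges everywhere, and the moments determine that function.\<close>

lemma real_distribution_eqI_moments:
  assumes "real_distribution M" "AE x in M. 0 \<le> x \<and> x \<le> 1"
    and "real_distribution N" "AE x in N. 0 \<le> x \<and> x \<le> 1"
    and eq: "\<And>n. (\<integral>x. x ^ n \<partial>M) = (\<integral>x. x ^ n \<partial>N)"
  shows "M = N"
proof (rule Levy_uniqueness[OF assms(1,3)], rule ext)
  fix t :: real
  have series: "(\<lambda>n. \<Sum>k\<le>n. ((\<i> * complex_of_real t) ^ k / fact k) * complex_of_real (\<integral>x. x ^ k \<partial>K)) \<longlonglongrightarrow> char K t"
    if "real_distribution K" and K: "AE x in K. 0 \<le> x \<and> x \<le> 1" for K :: "real measure"
  proof (rule Lim_transform2[OF tendsto_const])
    interpret real_distribution K by fact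
    have int: "integrable K (\<lambda>x. x ^ k)" for k
      by (rule unit_interval_power_integrable[OF finite_measure_axioms _ K]) simp
    have "cmod (char K t - (\<Sum>k\<le>n. ((\<i> * complex_of_real t) ^ k / fact k) * complex_of_real (expectation (\<lambda>x. x ^ k)))) \<le> 2 * (\<bar>t\<bar> ^ n / fact n)" for n
    proof -
      have "expectation (\<lambda>x. \<bar>x\<bar> ^ n) \<le> expectation (\<lambda>x. 1)"
        using integrable_abs[OF int[of n]] unfolding power_abs
        by (intro integral_mono_AE eventually_mono[OF K])
           (auto simp: power_le_one)
      then have "expectation (\<lambda>x. \<bar>x\<bar> ^ n) \<le> 1" using prob_space by simp
      then have "(2 * \<bar>t\<bar> ^ n / fact n) * expectation (\<lambda>x. \<bar>x\<bar> ^ n) \<le> (2 * \<bar>t\<bar> ^ n / fact n) * 1"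
        by (intro mult_left_mono) auto
      then show ?thesis using char_approx1[of n t, OF int] by simp
    qed
    moreover have "(\<lambda>n. 2 * (\<bar>t\<bar> ^ n / fact n)) \<longlonglongrightarrow> 0"
      using tendsto_mult_right_zero[OF summable_LIMSEQ_zero[OF summable_exp[of "\<bar>t\<bar>"]], of 2]
      unfolding divide_inverse by (simp only: mult.commute)
    ultimately show "(\<lambda>n. char K t - (\<Sum>k\<le>n. ((\<i> * complex_of_real t) ^ k / fact k) * complex_of_real (expectation (\<lambda>x. x ^ k)))) \<longlonglongrightarrow> 0"
      by (rule Lim_null_comparison[OF always_eventually, OF allI])
  qed
  show "char M t = char N t"
    using series[OF assms(1,2)] series[OF assms(3,4)] unfolding eq by (rule LIMSEQ_unique)
qed

text \<open>The zeroth moments give both measures the same mass \<open>c\<close>; for positive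
  \<open>c\<close>, division by \<open>c\<close> reduces to probability distributions.\<close>

theorem finite_measure_eqI_moments:
  fixes M N :: "real measure"
  assumes M: "finite_measure M" "sets M = sets borel" "AE x in M. 0 \<le> x \<and> x \<le> 1"
    and N: "finite_measure N" "sets N = sets borel" "AE x in N. 0 \<le> x \<and> x \<le> 1"
    and eq: "\<And>n. (\<integral>x. x ^ n \<partial>M) = (\<integral>x. x ^ n \<partial>N)"
  shows "M = N"
proof -
  define c where "c = measure M (space M)"
  have c_N: "c = measure N (space N)"
    using eq[of 0] by (simp add: c_def)
  have mass: "emeasure K (space K) = ennreal (measure K (space K))" if "finite_measure K" for K
    using that by (simp add: finite_measure.emeasure_eq_measure)
  show ?thesis
  proof (cases "c = 0")
    case True
    have "emeasure K A = 0" if "emeasure K (space K) = 0" for K :: "real measure" and A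
      using emeasure_space[of K A] that by simp
    then show ?thesis
      using True mass[OF M(1)] mass[OF N(1)] c_N M(2) N(2) by (intro measure_eqI) (auto simp: c_def)
  next
    case False
    then have c: "0 < c" by (simp add: c_def zero_less_measure_iff)
    define D where "D K = density K (\<lambda>_. ennreal (inverse c))" for K :: "real measure"
    have dist: "real_distribution (D K)" and AE_D: "AE x in D K. 0 \<le> x \<and> x \<le> 1"
      and int_D: "(\<integral>x. x ^ n \<partial>D K) = inverse c * (\<integral>x. x ^ n \<partial>K)"
      and rescale: "density (D K) (\<lambda>_. ennreal c) = K"
      if K: "finite_measure K" "sets K = sets borel" "AE x in K. 0 \<le> x \<and> x \<le> 1" "measure K (space K) = c" for K n
    proof -
      note K(2)[measurable_cong]
      have "emeasure (D K) (space (D K)) = 1"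
        using c mass[OF K(1)] K(4) by (simp add: D_def emeasure_density_const flip: ennreal_mult)
      then show "real_distribution (D K)"
        by (intro real_distribution.intro prob_spaceI real_distribution_axioms.intro) (simp_all add: D_def K(2))
      show "AE x in D K. 0 \<le> x \<and> x \<le> 1"
        unfolding D_def by (subst AE_density) (auto intro!: eventually_mono[OF K(3)])
      show "(\<integral>x. x ^ n \<partial>D K) = inverse c * (\<integral>x. x ^ n \<partial>K)"
        unfolding D_def using c by (subst integral_density) auto
      show "density (D K) (\<lambda>_. ennreal c) = K"
        using c unfolding D_def
        by (subst density_density_eq) (auto simp: density_1 simp flip: ennreal_mult)
    qed
    have "D M = D N"
      using dist[OF M] AE_D[OF M] int_D[OF M] dist[OF N] AE_D[OF N] int_D[OF N] c_N
      by (intro real_distribution_eqI_moments) (simp_all add: eq c_def)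
    then show ?thesis
      using rescale[OF M] rescale[OF N] c_N by (simp add: c_def)
  qed
qed

subsection \<open>The functions \<open>f_levy l\<close> and their integrals\<close>

lemma f_levy_at_1 [simp]: "f_levy l 1 = 0"
  by (simp add: f_levy_def)

text \<open>The derivative of \<open>f_levy l\<close> is \<open>exp (- (l * t))\<close>, which
  decreases in \<open>t\<close>, so an increment lies between its length times the derivatives at
  the two endpoints. The inequality \<open>1 + x \<le> exp x\<close> proves this directly.\<close>

lemma f_levy_diff_bounds:
  assumes "0 \<le> l" "t \<le> s"
  shows "(s - t) * exp (- (l * s)) \<le> f_levy l s - f_levy l t"
    and "f_levy l s - f_levy l t \<le> (s - t) * exp (- (l * t))"
proof -
  have *: "(s - t) * exp (- (l * s)) \<le> f_levy l s - f_levy l t \<and>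
      f_levy l s - f_levy l t \<le> (s - t) * exp (- (l * t))"
  proof (cases "l = 0")
    case False
    with assms have l: "0 < l" by simp
    have diff: "f_levy l s - f_levy l t = (exp (- (l * t)) - exp (- (l * s))) / l"
      using False by (simp add: f_levy_def diff_divide_distrib)
    have "exp (- (l * s)) * (1 + l * (s - t)) \<le> exp (- (l * s)) * exp (l * (s - t))"
      using exp_ge_add_one_self[of "l * (s - t)"] by simp
    also have "\<dots> = exp (- (l * t))" by (simp flip: exp_add add: algebra_simps)
    finally have lower: "l * ((s - t) * exp (- (l * s))) \<le> exp (- (l * t)) - exp (- (l * s))"
      by (simp add: algebra_simps)
    have "exp (- (l * t)) * (1 + - (l * (s - t))) \<le> exp (- (l * t)) * exp (- (l * (s - t)))"
      using exp_ge_add_one_self[of "- (l * (s - t))"] by simp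
    also have "\<dots> = exp (- (l * s))" by (simp flip: exp_add add: algebra_simps)
    finally have upper: "exp (- (l * t)) - exp (- (l * s)) \<le> l * ((s - t) * exp (- (l * t)))"
      by (simp add: algebra_simps)
    show ?thesis
      unfolding diff using lower upper l by (simp add: pos_le_divide_eq pos_divide_le_eq mult.commute)
  qed (simp add: f_levy_def)
  then show "(s - t) * exp (- (l * s)) \<le> f_levy l s - f_levy l t"
    "f_levy l s - f_levy l t \<le> (s - t) * exp (- (l * t))" by auto
qed

lemma f_levy_mono: "0 \<le> l \<Longrightarrow> t \<le> s \<Longrightarrow> f_levy l t \<le> f_levy l s"
  using f_levy_diff_bounds(1)[of l t s] by (smt (verit) exp_ge_zero mult_nonneg_nonneg)

text \<open>Since \<open>f_levy l 1 = 0\<close>, the value at \<open>t\<close> is an increment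
  between \<open>t\<close> and 1. The bound reduces integrability of \<open>f_levy\<close> to a
  finite Laplace transform at \<open>min t 1\<close>.\<close>

lemma f_levy_abs_le:
  assumes "0 \<le> l"
  shows "\<bar>f_levy l t\<bar> \<le> \<bar>t - 1\<bar> * exp (- (l * min t 1))"
proof (cases "t \<le> 1")
  case True
  then show ?thesis
    using f_levy_diff_bounds(2)[OF assms True] f_levy_mono[OF assms True] by simp
next
  case False
  then show ?thesis
    using f_levy_diff_bounds(2)[OF assms, of 1 t] f_levy_mono[OF assms, of 1 t] by simp
qed

lemma f_levy_measurable [measurable]: "(\<lambda>l. f_levy l t) \<in> borel_measurable borel"
  unfolding f_levy_def by measurable

text \<open>Constants drop out because the coefficients sum to zero. For \<open>l > 0\<close> what
  remains is \<open>- 1 / l\<close> times a kernel of product form, which gives minus a square; for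
  \<open>l = 0\<close> the kernel is a sum of functions of one variable, and the form is
  zero.\<close>

lemma neg_def_fun_f_levy:
  assumes "0 \<le> l"
  shows "neg_def_fun (f_levy l)"
  unfolding neg_def_fun_iff_real
proof (intro allI impI, elim conjE)
  fix n and x a :: "nat \<Rightarrow> real"
  assume a: "(\<Sum>j<n. a j) = 0"
  have aa: "(\<Sum>j<n. \<Sum>k<n. a j * a k * b) = 0" for b
    using a by (simp flip: sum_distrib_left sum_distrib_right)
  show "(\<Sum>j<n. \<Sum>k<n. a j * a k * f_levy l ((x j + x k) / 2)) \<le> 0"
  proof (cases "l = 0")
    case True
    have "(\<Sum>j<n. \<Sum>k<n. a j * a k * (x j / 2)) = (\<Sum>j<n. a j * (x j / 2)) * (\<Sum>k<n. a k)"
      unfolding sum_product by (simp add: mult_ac)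
    moreover have "(\<Sum>j<n. \<Sum>k<n. a j * a k * (x k / 2)) = (\<Sum>j<n. a j) * (\<Sum>k<n. a k * (x k / 2))"
      unfolding sum_product by (simp add: mult_ac)
    moreover have "a j * a k * f_levy l ((x j + x k) / 2) =
        a j * a k * (x j / 2) + a j * a k * (x k / 2) - a j * a k * 1" for j k
      using True by (simp add: f_levy_def field_simps)
    ultimately show ?thesis using aa[of 1] a by (simp only: sum.distrib sum_subtractf)
  next
    case False
    have "a j * a k * f_levy l ((x j + x k) / 2) =
        a j * a k * (exp (- l) / l) - (a j * exp (- (l * x j / 2))) * (a k * exp (- (l * x k / 2))) / l" for j k
    proof -
      have "exp (- (l * ((x j + x k) / 2))) = exp (- (l * x j / 2)) * exp (- (l * x k / 2))"
        by (simp flip: exp_add add: field_simps)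
      then show ?thesis using False by (simp add: f_levy_def field_simps)
    qed
    then have "(\<Sum>j<n. \<Sum>k<n. a j * a k * f_levy l ((x j + x k) / 2)) =
        - (\<Sum>j<n. \<Sum>k<n. (a j * exp (- (l * x j / 2))) * (a k * exp (- (l * x k / 2))) / l)"
      by (simp only: sum_subtractf aa)
    also have "\<dots> = - ((\<Sum>j<n. a j * exp (- (l * x j / 2)))\<^sup>2 / l)"
      by (simp add: sum_product power2_eq_square sum_divide_distrib)
    finally show ?thesis using assms by simp
  qed
qed

section \<open>Integrals against a Borel measure on the half line\<close>

context
  fixes \<mu> :: "real measure"
  assumes \<mu>: "borel_measure_nonneg \<mu>"
begin

lemma sets_borel_measure_nonneg: "sets \<mu> = sets (restrict_space borel {0..})"
  using \<mu> by (simp only: borel_measure_nonneg_def)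

lemma space_borel_measure_nonneg: "space \<mu> = {0..}"
  using sets_eq_imp_space_eq[OF sets_borel_measure_nonneg] by (simp add: space_restrict_space)

lemma measurable_borel_measure_nonneg: "f \<in> measurable borel N \<Longrightarrow> f \<in> measurable \<mu> N"
  unfolding measurable_cong_sets[OF sets_borel_measure_nonneg refl]
  by (rule measurable_restrict_space1)

lemma exp_measurable_borel_measure_nonneg: "(\<lambda>l. exp (- (l * t))) \<in> borel_measurable \<mu>"
  by (rule measurable_borel_measure_nonneg) measurable

lemma laplace_finite_iff: "laplace \<mu> t < \<infinity> \<longleftrightarrow> integrable \<mu> (\<lambda>l. exp (- (l * t)))"
  using exp_measurable_borel_measure_nonneg by (simp add: laplace_def integrable_iff_bounded)

lemma enn2real_laplace: "enn2real (laplace \<mu> t) = (\<integral>l. exp (- (l * t)) \<partial>\<mu>)"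
  unfolding laplace_def
  by (rule integral_eq_nn_integral[symmetric]) (auto simp: exp_measurable_borel_measure_nonneg)

text \<open>The increment of \<open>f_levy l\<close> from \<open>t / 2\<close> to \<open>t\<close>
  is integrable by assumption and at least \<open>t / 2 * exp (- (l * t))\<close>.\<close>

lemma laplace_finite_if_levy_representation:
  assumes rep: "levy_representation \<psi> c \<mu>" and t: "0 < t"
  shows "laplace \<mu> t < \<infinity>"
  unfolding laplace_finite_iff
proof (rule Bochner_Integration.integrable_bound)
  show "integrable \<mu> (\<lambda>l. 2 / t * (f_levy l t - f_levy l (t / 2)))"
    using rep t unfolding levy_representation_def by (intro integrable_mult_right integrable_diff) auto
  show "AE l in \<mu>. norm (exp (- (l * t))) \<le> norm (2 / t * (f_levy l t - f_levy l (t / 2)))"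
  proof (rule AE_I2)
    fix l assume "l \<in> space \<mu>"
    then have "t / 2 * exp (- (l * t)) \<le> f_levy l t - f_levy l (t / 2)"
      using f_levy_diff_bounds(1)[of l "t / 2" t] t by (simp add: space_borel_measure_nonneg)
    then have "exp (- (l * t)) \<le> 2 / t * (f_levy l t - f_levy l (t / 2))"
      using t by (simp add: field_simps)
    then show "norm (exp (- (l * t))) \<le> norm (2 / t * (f_levy l t - f_levy l (t / 2)))"
      unfolding real_norm_def abs_exp_cancel by (rule order.trans[OF _ abs_ge_self])
  qed
qed (rule exp_measurable_borel_measure_nonneg)

context
  assumes fin: "\<And>t. 0 < t \<Longrightarrow> laplace \<mu> t < \<infinity>"
begin

lemma integrable_exp_laplace: "0 < t \<Longrightarrow> integrable \<mu> (\<lambda>l. exp (- (l * t)))"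
  by (rule laplace_finite_iff[THEN iffD1, OF fin])

lemma integrable_f_levy:
  assumes "0 < t"
  shows "integrable \<mu> (\<lambda>l. f_levy l t)"
proof (rule Bochner_Integration.integrable_bound)
  show "integrable \<mu> (\<lambda>l. \<bar>t - 1\<bar> * exp (- (l * min t 1)))"
    using assms by (intro integrable_mult_right integrable_exp_laplace) auto
  show "AE l in \<mu>. norm (f_levy l t) \<le> norm (\<bar>t - 1\<bar> * exp (- (l * min t 1)))"
    by (rule AE_I2) (use f_levy_abs_le in \<open>simp add: space_borel_measure_nonneg abs_mult\<close>)
qed (rule measurable_borel_measure_nonneg, measurable)

text \<open>Convexity of the exponential passes to the integral, and a finite convex function on an
  open interval is continuous.\<close>

lemma laplace_continuous_on: "continuous_on {0<..} (\<lambda>t. \<integral>l. exp (- (l * t)) \<partial>\<mu>)"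
proof (rule convex_on_continuous)
  show "convex_on {0<..} (\<lambda>t. \<integral>l. exp (- (l * t)) \<partial>\<mu>)"
  proof (rule convex_onI)
    fix u x y :: real assume u: "0 < u" "u < 1" and xy: "x \<in> {0<..}" "y \<in> {0<..}"
    have "0 < (1 - u) * x + u * y" using u xy by (intro add_pos_pos mult_pos_pos) auto
    then have "(\<integral>l. exp (- (l * ((1 - u) * x + u * y))) \<partial>\<mu>) \<le>
        (\<integral>l. (1 - u) * exp (- (l * x)) + u * exp (- (l * y)) \<partial>\<mu>)"
    proof (intro integral_mono)
      show "exp (- (l * ((1 - u) * x + u * y))) \<le> (1 - u) * exp (- (l * x)) + u * exp (- (l * y))" for l
        using convex_onD[OF exp_convex, of u "- (l * x)" "- (l * y)"] u by (simp add: algebra_simps)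
    qed (use xy \<open>0 < (1 - u) * x + u * y\<close> in \<open>simp_all add: integrable_exp_laplace\<close>)
    also have "\<dots> = (1 - u) * (\<integral>l. exp (- (l * x)) \<partial>\<mu>) + u * (\<integral>l. exp (- (l * y)) \<partial>\<mu>)"
      using xy by (simp add: integrable_exp_laplace)
    finally show "(\<integral>l. exp (- (l * ((1 - u) *\<^sub>R x + u *\<^sub>R y))) \<partial>\<mu>)
        \<le> (1 - u) * (\<integral>l. exp (- (l * x)) \<partial>\<mu>) + u * (\<integral>l. exp (- (l * y)) \<partial>\<mu>)" by simp
  qed simp
qed simp

text \<open>The integrated bounds squeeze the difference quotient between \<open>D t\<close> and
  \<open>D y\<close>; continuity of \<open>D\<close> closes the gap.\<close>

lemma f_levy_integral_has_derivative:
  assumes t: "0 < t"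
  shows "((\<lambda>t. \<integral>l. f_levy l t \<partial>\<mu>) has_real_derivative (\<integral>l. exp (- (l * t)) \<partial>\<mu>)) (at t)"
proof -
  define F where "F t = (\<integral>l. f_levy l t \<partial>\<mu>)" for t
  define D where "D t = (\<integral>l. exp (- (l * t)) \<partial>\<mu>)" for t
  have bounds: "(s - r) * D s \<le> F s - F r \<and> F s - F r \<le> (s - r) * D r" if "0 < r" "r \<le> s" for r s
  proof -
    have rs: "integrable \<mu> (\<lambda>l. f_levy l s)" "integrable \<mu> (\<lambda>l. f_levy l r)"
      "integrable \<mu> (\<lambda>l. exp (- (l * s)))" "integrable \<mu> (\<lambda>l. exp (- (l * r)))"
      using that by (simp_all add: integrable_f_levy integrable_exp_laplace)
    then have "F s - F r = (\<integral>l. f_levy l s - f_levy l r \<partial>\<mu>)" by (simp add: F_def)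
    moreover have "(\<integral>l. (s - r) * exp (- (l * s)) \<partial>\<mu>) \<le> (\<integral>l. f_levy l s - f_levy l r \<partial>\<mu>)"
    proof (rule integral_mono)
      show "(s - r) * exp (- (l * s)) \<le> f_levy l s - f_levy l r" if "l \<in> space \<mu>" for l
        using that \<open>r \<le> s\<close> by (intro f_levy_diff_bounds) (simp_all add: space_borel_measure_nonneg)
    qed (use rs in simp_all)
    moreover have "(\<integral>l. f_levy l s - f_levy l r \<partial>\<mu>) \<le> (\<integral>l. (s - r) * exp (- (l * r)) \<partial>\<mu>)"
    proof (rule integral_mono)
      show "f_levy l s - f_levy l r \<le> (s - r) * exp (- (l * r))" if "l \<in> space \<mu>" for l
        using that \<open>r \<le> s\<close> by (intro f_levy_diff_bounds) (simp_all add: space_borel_measure_nonneg)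
    qed (use rs in simp_all)
    ultimately show ?thesis by (simp add: D_def)
  qed
  have slope: "\<bar>(F y - F t) / (y - t) - D t\<bar> \<le> \<bar>D y - D t\<bar>" if "0 < y" "y \<noteq> t" for y
  proof (cases "y < t")
    case True
    then have "D t \<le> (F y - F t) / (y - t)" "(F y - F t) / (y - t) \<le> D y"
      using bounds[of y t] that by (auto simp: neg_le_divide_eq neg_divide_le_eq algebra_simps)
    then show ?thesis by simp
  next
    case False
    then have "D y \<le> (F y - F t) / (y - t)" "(F y - F t) / (y - t) \<le> D t"
      using bounds[of t y] that t by (auto simp: pos_le_divide_eq pos_divide_le_eq algebra_simps)
    then show ?thesis by simp
  qed
  have "isCont D t"
    using laplace_continuous_on t by (simp add: continuous_on_eq_continuous_at D_def[abs_def])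
  then have "((\<lambda>y. \<bar>D y - D t\<bar>) \<longlongrightarrow> 0) (at t)"
    by (intro tendsto_rabs_zero) (simp add: LIM_zero_iff isCont_def)
  moreover have "\<forall>\<^sub>F y in at t. norm ((F y - F t) / (y - t) - D t) \<le> \<bar>D y - D t\<bar>"
    using eventually_at_in_open[of "{0<..}" t] t by (auto elim!: eventually_mono intro: slope)
  ultimately have "((\<lambda>y. (F y - F t) / (y - t) - D t) \<longlongrightarrow> 0) (at t)"
    by (rule Lim_null_comparison[rotated])
  then show ?thesis
    by (simp add: has_field_derivative_iff LIM_zero_iff F_def D_def)
qed

text \<open>The quadratic form of the integral is the integral of the quadratic forms of the
  \<open>f_levy l\<close>, each of them nonpositive.\<close>

lemma neg_def_fun_f_levy_integral: "neg_def_fun (\<lambda>t. c + (\<integral>l. f_levy l t \<partial>\<mu>))"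
  unfolding neg_def_fun_iff_real
proof (intro allI impI, elim conjE)
  fix n and x a :: "nat \<Rightarrow> real"
  assume x: "\<forall>j<n. 0 < x j" and a: "(\<Sum>j<n. a j) = 0"
  have int: "integrable \<mu> (\<lambda>l. f_levy l ((x j + x k) / 2))" if "j < n" "k < n" for j k
    using x that by (intro integrable_f_levy) (simp add: add_pos_pos)
  have "(\<Sum>j<n. \<Sum>k<n. a j * a k * c) = 0"
    using a by (simp flip: sum_distrib_left sum_distrib_right)
  then have "(\<Sum>j<n. \<Sum>k<n. a j * a k * (c + (\<integral>l. f_levy l ((x j + x k) / 2) \<partial>\<mu>))) =
      (\<Sum>j<n. \<Sum>k<n. a j * a k * (\<integral>l. f_levy l ((x j + x k) / 2) \<partial>\<mu>))"
    by (simp add: distrib_left sum.distrib)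
  also have "\<dots> = (\<integral>l. (\<Sum>j<n. \<Sum>k<n. a j * a k * f_levy l ((x j + x k) / 2)) \<partial>\<mu>)"
    by (intro has_bochner_integral_integral_eq[symmetric] has_bochner_integral_sum
          has_bochner_integral_mult_right has_bochner_integral_integrable int) auto
  also have "\<dots> \<le> 0"
  proof -
    have "0 \<le> (\<integral>l. - (\<Sum>j<n. \<Sum>k<n. a j * a k * f_levy l ((x j + x k) / 2)) \<partial>\<mu>)"
      using neg_def_fun_f_levy x a unfolding neg_def_fun_iff_real
      by (intro integral_nonneg_AE AE_I2) (simp add: space_borel_measure_nonneg)
    then show ?thesis by simp
  qed
  finally show "(\<Sum>j<n. \<Sum>k<n. a j * a k * (c + (\<integral>l. f_levy l ((x j + x k) / 2) \<partial>\<mu>))) \<le> 0" .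
qed

lemma mono_on_f_levy_integral: "mono_on {0<..} (\<lambda>t. c + (\<integral>l. f_levy l t \<partial>\<mu>))"
  by (intro mono_onI add_left_mono integral_mono integrable_f_levy f_levy_mono)
     (auto simp: space_borel_measure_nonneg)

end

end

section \<open>From the representation to the function\<close>

lemma neg_def_fun_cong: "(\<And>t. 0 < t \<Longrightarrow> f t = g t) \<Longrightarrow> neg_def_fun f \<longleftrightarrow> neg_def_fun g"
  unfolding neg_def_fun_iff_real
  by (intro all_cong1 imp_cong refl arg_cong[of _ _ "\<lambda>r. r \<le> 0"] sum.cong) (auto simp: add_pos_pos)

lemma levy_representation_imp_neg_def_increasing:
  assumes "borel_measure_nonneg \<mu>" "levy_representation \<psi> c \<mu>"
  shows "neg_def_fun \<psi>" "mono_on {0<..} \<psi>"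
proof -
  have rep: "\<psi> t = c + (\<integral>l. f_levy l t \<partial>\<mu>)" if "0 < t" for t
    using assms(2) that by (simp add: levy_representation_def)
  note fin = laplace_finite_if_levy_representation[OF assms]
  show "neg_def_fun \<psi>"
    using neg_def_fun_f_levy_integral[OF assms(1) fin, of c] neg_def_fun_cong[of \<psi>, OF rep] by simp
  show "mono_on {0<..} \<psi>"
    using mono_on_f_levy_integral[OF assms(1) fin, of c] rep by (auto simp: mono_on_def)
qed

lemma levy_representation_deriv_eq_laplace:
  assumes "borel_measure_nonneg \<mu>" "levy_representation \<psi> c \<mu>"
  shows "deriv_eq_laplace \<psi> \<mu>"
  unfolding deriv_eq_laplace_def
proof (intro allI impI conjI)
  note fin = laplace_finite_if_levy_representation[OF assms]
  fix t :: real assume t: "0 < t"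
  show "laplace \<mu> t < \<infinity>" by (rule fin[OF t])
  have "((\<lambda>t. c + (\<integral>l. f_levy l t \<partial>\<mu>)) has_real_derivative enn2real (laplace \<mu> t)) (at t)"
    using f_levy_integral_has_derivative[OF assms(1) fin t]
    by (auto intro!: derivative_eq_intros simp: enn2real_laplace[OF assms(1)])
  then show "(\<psi> has_real_derivative enn2real (laplace \<mu> t)) (at t)"
    by (rule has_field_derivative_transform_within_open[of _ _ _ "{0<..}"])
       (use t assms(2) in \<open>auto simp: levy_representation_def\<close>)
qed

subsection \<open>Existence and uniqueness of the representing measure\<close>

text \<open>The Hausdorff measure \<open>\<rho> k\<close> belongs to the progression of step
  \<open>1 / 2 ^ k\<close>. The substitution \<open>y = x ^ (2 ^ k)\<close> and the density
  \<open>w k\<close> turn it into \<open>\<sigma> k\<close>, whose integer moments do not depend on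
  \<open>k \<ge> 1\<close>, so one measure serves all dyadic exponents.\<close>

lemma increasing_function_unit_moments:
  assumes "neg_def_fun \<psi>" "mono_on {0<..} \<psi>"
  obtains \<sigma> :: "real measure" where "finite_measure \<sigma>" "sets \<sigma> = sets borel" "AE y in \<sigma>. 0 < y \<and> y \<le> 1"
    "\<And>k m. 1 \<le> k \<Longrightarrow> 2 \<le> m \<Longrightarrow>
       has_bochner_integral \<sigma> (\<lambda>y. y powr (real m / 2 ^ k - 1)) (\<psi> (real m / 2 ^ k + 1) - \<psi> (real m / 2 ^ k))"
proof -
  define G where "G t = \<psi> (t + 1) - \<psi> t" for t
  have "\<exists>\<rho>. finite_measure \<rho> \<and> sets \<rho> = sets borel \<and> (AE x in \<rho>. 0 \<le> x \<and> x \<le> 1) \<and>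
      (\<forall>n. has_bochner_integral \<rho> (\<lambda>x. x ^ n) (G (1 / 2 ^ k + real n / 2 ^ k)))" for k
  proof -
    \<comment> \<open>The progression starts at \<open>1 / 2 ^ k\<close> because 0 lies outside the
      domain; so the n-th moment belongs to the argument \<open>(n + 1) / 2 ^ k\<close>.\<close>
    have "completely_monotone_seq (\<lambda>n. G (1 / 2 ^ k + real n / 2 ^ k))"
      unfolding G_def by (rule neg_def_increasing_unit_increments[OF assms]) simp
    then show ?thesis by (rule hausdorff_moment) blast
  qed
  then obtain \<rho> where \<rho>_fin: "\<And>k. finite_measure (\<rho> k)" and \<rho>_sets: "\<And>k. sets (\<rho> k) = sets (borel :: real measure)"
    and \<rho>_01: "\<And>k. AE x in \<rho> k. 0 \<le> x \<and> x \<le> 1"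
    and \<rho>_mom: "\<And>k n. has_bochner_integral (\<rho> k) (\<lambda>x. x ^ n) (G (1 / 2 ^ k + real n / 2 ^ k))"
    by metis
  note \<rho>_sets[measurable_cong]
  \<comment> \<open>With \<open>t = (n + 1) / 2 ^ k\<close> and \<open>x > 0\<close>, the power
    \<open>x ^ n\<close> is \<open>y powr (t - 1 / 2 ^ k)\<close>, that is
    \<open>y powr (t - 1)\<close> times this density. The value 0 outside (0,1] removes a possible
    atom at 0.\<close>
  define w :: "nat \<Rightarrow> real \<Rightarrow> real" where "w k y = (if 0 < y \<and> y \<le> 1 then y powr (1 - 1 / 2 ^ k) else 0)" for k y
  define \<sigma> where "\<sigma> k = density (distr (\<rho> k) borel (\<lambda>x. x ^ (2 ^ k))) (\<lambda>y. ennreal (w k y))" for k :: nat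
  have w_measurable[measurable]: "w k \<in> borel_measurable borel" for k
    unfolding w_def[abs_def] by measurable
  have w_nonneg: "0 \<le> w k y" for k y by (simp add: w_def)
  have \<sigma>_sets: "sets (\<sigma> k) = sets borel" for k by (simp add: \<sigma>_def)
  note \<sigma>_sets[measurable_cong]
  have \<sigma>_01: "AE y in \<sigma> k. 0 < y \<and> y \<le> 1" for k
    unfolding \<sigma>_def by (subst AE_density) (auto simp: w_def split: if_splits)
  have \<sigma>_int: "has_bochner_integral (\<sigma> k) f (G (1 / 2 ^ k + real p / 2 ^ k))"
    if [measurable]: "f \<in> borel_measurable borel" and "\<And>x. 0 \<le> x \<Longrightarrow> x \<le> 1 \<Longrightarrow> w k (x ^ 2 ^ k) * f (x ^ 2 ^ k) = x ^ p" for k p and f :: "real \<Rightarrow> real"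
  proof -
    have "has_bochner_integral (\<rho> k) (\<lambda>x. w k (x ^ 2 ^ k) *\<^sub>R f (x ^ 2 ^ k)) (G (1 / 2 ^ k + real p / 2 ^ k))"
      using \<rho>_mom[of k p]
      by (subst has_bochner_integral_cong_AE[of _ _ "\<lambda>x. x ^ p"])
         (auto intro!: eventually_mono[OF \<rho>_01[of k]] simp: that)
    then show ?thesis
      unfolding \<sigma>_def
      by (intro has_bochner_integral_density has_bochner_integral_distr) (auto simp: w_nonneg)
  qed
  have power_powr: "(x ^ 2 ^ k) powr a = x powr (2 ^ k * a)" if "0 < x" for x a :: real and k :: nat
    using powr_powr[of x "2 ^ k" a] powr_realpow[of x "2 ^ k"] that by simp
  have w_power: "w k (x ^ 2 ^ k) = x powr (2 ^ k - 1)" if "0 < x" "x \<le> 1" for k x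
  proof -
    have "w k (x ^ 2 ^ k) = (x ^ 2 ^ k) powr (1 - 1 / 2 ^ k)"
      using that by (simp add: w_def power_le_one)
    also have "\<dots> = x powr (2 ^ k - 1)"
      using that by (simp add: power_powr right_diff_distrib)
    finally show ?thesis .
  qed
  have moments: "has_bochner_integral (\<sigma> k) (\<lambda>y. y ^ n) (G (real n + 1))" if k: "1 \<le> k" for k n
  proof -
    have k2: "(2::nat) \<le> 2 ^ k" using k by (cases k) auto
    then have "1 \<le> 2 ^ k * n + 2 ^ k" by (intro trans_le_add2) simp
    from of_nat_diff[OF this, where 'a = real]
    have exponent: "real (2 ^ k * n + 2 ^ k - 1) = 2 ^ k * real n + 2 ^ k - 1" by simp
    \<comment> \<open>For \<open>1 \<le> k\<close> the exponent \<open>2 ^ k * (n + 1) - 1\<close>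
      is positive, so the power of \<open>x\<close> vanishes at 0 together with
      \<open>w\<close>.\<close>
    have "has_bochner_integral (\<sigma> k) (\<lambda>y. y ^ n) (G (1 / 2 ^ k + real (2 ^ k * n + 2 ^ k - 1) / 2 ^ k))"
    proof (rule \<sigma>_int)
      fix x :: real assume x: "0 \<le> x" "x \<le> 1"
      show "w k (x ^ 2 ^ k) * (x ^ 2 ^ k) ^ n = x ^ (2 ^ k * n + 2 ^ k - 1)"
      proof (cases "x = 0")
        case True
        then show ?thesis using k2 by (simp add: w_def zero_power)
      next
        case False
        then have "w k (x ^ 2 ^ k) * (x ^ 2 ^ k) ^ n = x powr (2 ^ k - 1) * x powr (2 ^ k * n)"
          using x powr_realpow[of x "2 ^ k * n"] by (simp add: w_power flip: power_mult)
        also have "\<dots> = x powr real (2 ^ k * n + 2 ^ k - 1)"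
          unfolding exponent by (simp add: algebra_simps flip: powr_add)
        finally show ?thesis using False x by (simp add: powr_realpow)
      qed
    qed measurable
    also have "1 / 2 ^ k + real (2 ^ k * n + 2 ^ k - 1) / 2 ^ k = real n + 1"
      unfolding exponent by (simp add: field_simps)
    finally show ?thesis .
  qed
  have \<sigma>_fin: "finite_measure (\<sigma> k)" if "1 \<le> k" for k
  proof (rule finite_measureI)
    have "integrable (\<sigma> k) (\<lambda>y. 1 :: real)" using moments[OF that, of 0] by (simp add: has_bochner_integral_iff)
    then show "emeasure (\<sigma> k) (space (\<sigma> k)) \<noteq> \<infinity>" by (simp add: integrable_iff_bounded)
  qed
  have \<sigma>_eq: "\<sigma> k = \<sigma> 1" if "1 \<le> k" for k
  proof (rule finite_measure_eqI_moments)
    show "(\<integral>x. x ^ n \<partial>\<sigma> k) = (\<integral>x. x ^ n \<partial>\<sigma> 1)" for n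
      using moments[OF that, of n] moments[of 1 n] by (simp add: has_bochner_integral_iff)
  qed (use that \<sigma>_fin \<sigma>_sets in \<open>auto intro: eventually_mono[OF \<sigma>_01]\<close>)
  show ?thesis
  proof (rule that[of "\<sigma> 1"])
    fix k m :: nat assume k: "1 \<le> k" and m: "2 \<le> m"
    \<comment> \<open>Likewise \<open>2 \<le> m\<close> makes \<open>x ^ (m - 1)\<close> vanish at
      0.\<close>
    have "has_bochner_integral (\<sigma> k) (\<lambda>y. y powr (real m / 2 ^ k - 1)) (G (1 / 2 ^ k + real (m - 1) / 2 ^ k))"
    proof (rule \<sigma>_int)
      fix x :: real assume x: "0 \<le> x" "x \<le> 1"
      show "w k (x ^ 2 ^ k) * (x ^ 2 ^ k) powr (real m / 2 ^ k - 1) = x ^ (m - 1)"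
      proof (cases "x = 0")
        case True
        then show ?thesis using m by (simp add: w_def zero_power)
      next
        case False
        then have "(x ^ 2 ^ k) powr (real m / 2 ^ k - 1) = x powr (real m - 2 ^ k)"
          using x by (simp add: power_powr right_diff_distrib)
        then have "w k (x ^ 2 ^ k) * (x ^ 2 ^ k) powr (real m / 2 ^ k - 1) = x powr real (m - 1)"
          using x False m by (simp add: w_power of_nat_diff flip: powr_add)
        then show ?thesis using False x by (simp add: powr_realpow)
      qed
    qed measurable
    also have "1 / 2 ^ k + real (m - 1) / 2 ^ k = real m / 2 ^ k"
      using m by (simp add: of_nat_diff field_simps)
    finally show "has_bochner_integral (\<sigma> 1) (\<lambda>y. y powr (real m / 2 ^ k - 1)) (\<psi> (real m / 2 ^ k + 1) - \<psi> (real m / 2 ^ k))"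
      unfolding G_def \<sigma>_eq[OF k] .
  qed (use \<sigma>_fin \<sigma>_sets \<sigma>_01 in auto)
qed

text \<open>Dyadic points just below and just above \<open>t\<close> trap \<open>f t\<close> between
  values of \<open>g\<close>, and continuity of \<open>g\<close> makes both bounds tend to
  \<open>g t\<close>.\<close>

lemma eq_on_dyadics_imp_eq:
  fixes f g :: "real \<Rightarrow> real"
  assumes mono: "mono_on {0<..} f" and cont: "continuous_on {0<..} g"
    and eq: "\<And>k m. 1 \<le> m \<Longrightarrow> f (real m / 2 ^ k) = g (real m / 2 ^ k)" and t: "0 < t"
  shows "f t = g t"
proof -
  define N where "N k = nat \<lfloor>t * 2 ^ k\<rfloor>" for k :: nat
  have N: "real (N k) \<le> t * 2 ^ k" "t * 2 ^ k \<le> real (N k) + 1" for k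
    using t by (auto simp: N_def of_nat_nat)
  have N'_upper: "t \<le> real (N k + 1) / 2 ^ k" for k
    using N(2)[of k] by (simp add: pos_le_divide_eq add.commute)
  have N': "t - 1 / 2 ^ k \<le> real (N k) / 2 ^ k" "real (N k) / 2 ^ k \<le> t" for k
    using N(1)[of k] N'_upper[of k] unfolding of_nat_add add_divide_distrib
    by (simp_all add: pos_divide_le_eq)
  have lo: "(\<lambda>k. real (N k) / 2 ^ k) \<longlonglongrightarrow> t"
  proof (rule tendsto_sandwich)
    show "(\<lambda>k. t - 1 / 2 ^ k) \<longlonglongrightarrow> t" by real_asymp
    show "(\<lambda>k. t) \<longlonglongrightarrow> t" by (rule tendsto_const)
  qed (use N' in auto)
  have hi: "(\<lambda>k. real (N k + 1) / 2 ^ k) \<longlonglongrightarrow> t"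
  proof -
    have "(\<lambda>k. 1 / 2 ^ k :: real) \<longlonglongrightarrow> 0" by real_asymp
    from tendsto_add[OF lo this] show ?thesis by (simp add: add_divide_distrib add.commute)
  qed
  have g: "isCont g t" using cont t by (simp add: continuous_on_eq_continuous_at)
  \<comment> \<open>For small \<open>k\<close> the lower dyadic point may be 0, outside the
    domain.\<close>
  have "\<forall>\<^sub>F k in sequentially. 0 < real (N k) / 2 ^ k"
    using lo t by (rule order_tendstoD)
  then have "\<forall>\<^sub>F k in sequentially. g (real (N k) / 2 ^ k) \<le> f t"
  proof eventually_elim
    case (elim k)
    then have "1 \<le> N k" by (cases "N k") auto
    then show ?case using N'(2)[of k] elim t by (subst eq[symmetric]) (auto intro!: mono_onD[OF mono])
  qed
  then have le: "g t \<le> f t"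
    by (rule tendsto_upperbound[OF isCont_tendsto_compose[OF g lo]]) simp
  have "f t \<le> g (real (N k + 1) / 2 ^ k)" for k
    using N'_upper[of k] t by (subst eq[symmetric]) (auto intro!: mono_onD[OF mono])
  then have "f t \<le> g t"
    by (intro tendsto_lowerbound[OF isCont_tendsto_compose[OF g hi]] always_eventually) auto
  with le show ?thesis by simp
qed

text \<open>
  The increments of step \<open>1 / 2^k\<close> decrease along arithmetic progressions, so they converge to
  \<open>1 / 2^k\<close> times the limit of the unit increments. Hence the difference of two functions with
  the same unit increments has periodic increments of step \<open>1 / 2^k\<close> tending to \<open>0\<close>.
\<close>

lemma unit_increments_determine_increasing_function:
  assumes \<psi>: "neg_def_fun \<psi>" "mono_on {0<..} \<psi>"
    and \<phi>: "neg_def_fun \<phi>" "mono_on {0<..} \<phi>" "continuous_on {0<..} \<phi>"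
    and unit: "\<And>k m. 1 \<le> k \<Longrightarrow> 2 \<le> m \<Longrightarrow>
      \<psi> (real m / 2 ^ k + 1) - \<psi> (real m / 2 ^ k) = \<phi> (real m / 2 ^ k + 1) - \<phi> (real m / 2 ^ k)"
    and t: "0 < t"
  shows "\<psi> t = \<phi> t + (\<psi> 1 - \<phi> 1)"
proof (rule eq_on_dyadics_imp_eq[OF \<psi>(2) _ _ t])
  show "continuous_on {0<..} (\<lambda>t. \<phi> t + (\<psi> 1 - \<phi> 1))"
    by (intro continuous_intros \<phi>(3))
  fix k m :: nat assume m: "1 \<le> m"
  define h :: real where "h = 1 / 2 ^ k"
  have h: "0 < h" by (simp add: h_def)
  define v where "v f n = f (h + real (Suc n) * h) - f (h + real n * h)" for f :: "real \<Rightarrow> real" and n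
  have sum_v: "(\<Sum>i<2 ^ k. v f (n + i)) = f (real (Suc n) / 2 ^ k + 1) - f (real (Suc n) / 2 ^ k)" for f n
    using sum_lessThan_telescope[of "\<lambda>i. f (h + real (n + i) * h)" "2 ^ k"]
    by (simp add: v_def h_def add_divide_distrib add_ac)
  have unit': "\<psi> (real (Suc n) / 2 ^ k + 1) - \<psi> (real (Suc n) / 2 ^ k)
      = \<phi> (real (Suc n) / 2 ^ k + 1) - \<phi> (real (Suc n) / 2 ^ k)" for n
  proof -
    \<comment> \<open>Doubling the numerator and raising the exponent to \<open>Suc k\<close> meets
      the conditions on \<open>k\<close> and \<open>m\<close> in \<open>unit\<close>.\<close>
    have "real (2 * Suc n) / 2 ^ Suc k = real (Suc n) / 2 ^ k"
      unfolding of_nat_mult power_Suc by (simp del: of_nat_Suc)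
    then show ?thesis using unit[of "Suc k" "2 * Suc n"] by (simp only:) simp
  qed
  have "\<exists>L. v f \<longlonglongrightarrow> L" if "neg_def_fun f" "mono_on {0<..} f" for f
  proof -
    have cm: "completely_monotone_seq (v f)"
      unfolding v_def using neg_def_increasing_increments[OF that h, of h] h by simp
    show ?thesis
      using decseq_convergent[OF completely_monotone_seq_decseq[OF cm], of 0]
        completely_monotone_seq_nonneg[OF cm] by metis
  qed
  then obtain L L' where L: "v \<psi> \<longlonglongrightarrow> L" and L': "v \<phi> \<longlonglongrightarrow> L'" using \<psi> \<phi> by metis
  have sum_lim: "(\<lambda>n. \<Sum>i<2 ^ k. w (n + i)) \<longlonglongrightarrow> (\<Sum>i<(2::nat) ^ k. l)"
    if "w \<longlonglongrightarrow> l" for w :: "nat \<Rightarrow> real" and l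
    using that by (intro tendsto_sum LIMSEQ_ignore_initial_segment)
  \<comment> \<open>Blocks of \<open>2 ^ k\<close> consecutive small increments are unit increments,
    which agree for both functions, so the limits agree too.\<close>
  have "(\<Sum>i<(2::nat) ^ k. L) = (\<Sum>i<(2::nat) ^ k. L')"
    using sum_lim[OF L] sum_lim[OF L'] unfolding sum_v unit' by (rule LIMSEQ_unique)
  then have "L = L'" by simp
  then have e_lim: "(\<lambda>n. v \<psi> n - v \<phi> n) \<longlonglongrightarrow> 0"
    using tendsto_diff[OF L L'] by simp
  define u where "u n = \<psi> (h + real n * h) - \<phi> (h + real n * h)" for n
  have u_period: "u (n + 2 ^ k) = u n" for n
    using unit'[of n] by (simp add: u_def h_def add_divide_distrib add_ac)
  have u_period': "u (n + j * 2 ^ k) = u n" for n j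
  proof (induction j)
    case (Suc j)
    then show ?case using u_period[of "n + j * 2 ^ k"] by (simp add: add_ac)
  qed simp
  have e_u: "v \<psi> n - v \<phi> n = u (Suc n) - u n" for n by (simp add: v_def u_def)
  have u_const: "u (Suc n) = u n" for n
  proof -
    \<comment> \<open>Along this subsequence the difference is constant by periodicity, and it tends
      to 0.\<close>
    have "strict_mono (\<lambda>j. n + j * 2 ^ k)" by (rule strict_monoI) simp
    from LIMSEQ_subseq_LIMSEQ[OF e_lim this]
    have "(\<lambda>j. u (Suc n + j * 2 ^ k) - u (n + j * 2 ^ k)) \<longlonglongrightarrow> 0"
      by (simp add: o_def e_u)
    then show ?thesis unfolding u_period' by (simp add: tendsto_const_iff)
  qed
  have u0: "u n = u 0" for n by (induction n) (simp_all add: u_const)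
  have u_at: "u (n - 1) = \<psi> (real n / 2 ^ k) - \<phi> (real n / 2 ^ k)" if "1 \<le> n" for n
    using that by (simp add: u_def h_def of_nat_diff field_simps)
  \<comment> \<open>The progression starts at \<open>h\<close>, so the index
    \<open>2 ^ k - 1\<close> belongs to the argument 1; this identifies the constant.\<close>
  have "u (m - 1) = u (2 ^ k - 1)" using u0 by metis
  then show "\<psi> (real m / 2 ^ k) = \<phi> (real m / 2 ^ k) + (\<psi> 1 - \<phi> 1)"
    using u_at[OF m] u_at[of "2 ^ k"] by simp
qed

section \<open>Transport between (0,1] and the half line by y = exp(-l)\<close>

definition neg_ln :: "real \<Rightarrow> real" where
  "neg_ln y = (if 0 < y \<and> y \<le> 1 then - ln y else 0)"

lemma neg_ln_measurable [measurable]: "neg_ln \<in> measurable borel (restrict_space borel {0..})"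
proof (rule measurable_restrict_space2)
  show "neg_ln \<in> borel_measurable borel" unfolding neg_ln_def[abs_def] by measurable
\<comment> \<open>The default value 0 keeps the image of the whole line inside the half
  line.\<close>
qed (simp add: neg_ln_def)

text \<open>The reciprocal of \<open>(1 - exp (- l)) / l\<close>, which is the ratio of a unit
  increment of \<open>f_levy l\<close> to \<open>exp (- (l * t))\<close>, extended by its limit at
  0.\<close>

definition unit_increment_weight :: "real \<Rightarrow> real" where
  "unit_increment_weight l = (if l = 0 then 1 else l / (1 - exp (- l)))"

lemma unit_increment_weight_measurable [measurable]: "unit_increment_weight \<in> borel_measurable borel"
  unfolding unit_increment_weight_def[abs_def] by measurable

lemma unit_increment_weight_nonneg: "0 \<le> l \<Longrightarrow> 0 \<le> unit_increment_weight l"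
  by (simp add: unit_increment_weight_def)

lemma unit_increment_weight_le:
  assumes "0 \<le> l"
  shows "unit_increment_weight l \<le> 1 + l"
proof (cases "l = 0")
  case False
  have "exp (- l) * (1 + l) \<le> exp (- l) * exp l"
    using exp_ge_add_one_self[of l] by (intro mult_left_mono) auto
  then have "exp (- l) * (1 + l) \<le> 1" by (simp flip: exp_add)
  then show ?thesis
    using False assms by (simp add: unit_increment_weight_def pos_divide_le_eq algebra_simps)
qed (simp add: unit_increment_weight_def)

lemma f_levy_unit_increment:
  "unit_increment_weight l * (f_levy l (t + 1) - f_levy l t) = exp (- (l * t))"
proof (cases "l = 0")
  case False
  have "exp (- (l * (t + 1))) = exp (- (l * t)) * exp (- l)"
    by (simp flip: exp_add add: algebra_simps)
  then have "f_levy l (t + 1) - f_levy l t = exp (- (l * t)) * (1 - exp (- l)) / l"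
    using False by (simp add: f_levy_def field_simps)
  then show ?thesis using False by (simp add: unit_increment_weight_def)
qed (simp add: unit_increment_weight_def f_levy_def)

text \<open>The weight grows at most linearly, and \<open>exp (- (l * (t - s)))\<close> absorbs that
  growth. So integrability of one unit increment at \<open>s\<close> yields a finite Laplace
  transform at every \<open>t > s\<close>.\<close>

lemma exp_le_f_levy_unit_increment:
  assumes l: "0 \<le> l" and s: "s < t"
  shows "exp (- (l * t)) \<le> (1 + 1 / (t - s)) * (f_levy l (s + 1) - f_levy l s)"
proof -
  define d where "d = t - s"
  have d: "0 < d" using s by (simp add: d_def)
  define F where "F = f_levy l (s + 1) - f_levy l s"
  have F: "0 \<le> F" using f_levy_mono[OF l, of s "s + 1"] by (simp add: F_def)
  have "1 + l \<le> (1 + 1 / d) * (1 + l * d)"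
    using d l by (simp add: field_simps)
  also have "\<dots> \<le> (1 + 1 / d) * exp (l * d)"
    using exp_ge_add_one_self[of "l * d"] d by (intro mult_left_mono) auto
  finally have "exp (- (l * d)) * (1 + l) \<le> exp (- (l * d)) * ((1 + 1 / d) * exp (l * d))"
    by (intro mult_left_mono) auto
  also have "\<dots> = 1 + 1 / d" by (simp add: mult.left_commute flip: exp_add)
  finally have weight: "exp (- (l * d)) * (1 + l) \<le> 1 + 1 / d" .
  have "exp (- (l * t)) = exp (- (l * d)) * exp (- (l * s))"
    by (simp add: d_def algebra_simps flip: exp_add)
  also have "\<dots> = exp (- (l * d)) * (unit_increment_weight l * F)"
    by (simp add: F_def f_levy_unit_increment)
  also have "\<dots> \<le> exp (- (l * d)) * ((1 + l) * F)"
    by (intro mult_left_mono mult_right_mono unit_increment_weight_le l F) auto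
  also have "\<dots> \<le> (1 + 1 / d) * F"
    using mult_right_mono[OF weight F] by (simp add: mult.assoc)
  finally show ?thesis by (simp add: d_def F_def)
qed

theorem neg_def_increasing_imp_levy_representation:
  assumes \<psi>: "neg_def_fun \<psi>" "mono_on {0<..} \<psi>"
  obtains \<mu> where "borel_measure_nonneg \<mu>" "levy_representation \<psi> (\<psi> 1) \<mu>"
proof -
  obtain \<sigma> :: "real measure" where \<sigma>: "finite_measure \<sigma>" "sets \<sigma> = sets borel" "AE y in \<sigma>. 0 < y \<and> y \<le> 1"
    and \<sigma>_int: "\<And>k m. 1 \<le> k \<Longrightarrow> 2 \<le> m \<Longrightarrow>
       has_bochner_integral \<sigma> (\<lambda>y. y powr (real m / 2 ^ k - 1)) (\<psi> (real m / 2 ^ k + 1) - \<psi> (real m / 2 ^ k))"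
    by (fact increasing_function_unit_moments[OF \<psi>])
  note \<sigma>(2)[measurable_cong]
  let ?N = "restrict_space borel {0::real..}"
  \<comment> \<open>With \<open>y = exp (- l)\<close>, the function \<open>y powr (t - 1)\<close>
    becomes \<open>exp l * exp (- (l * t))\<close>, which is this density times a unit increment of
    \<open>f_levy l\<close>.\<close>
  define \<mu> where "\<mu> = density (distr \<sigma> ?N neg_ln) (\<lambda>l. ennreal (unit_increment_weight l * exp l))"
  have \<mu>: "borel_measure_nonneg \<mu>" by (simp add: borel_measure_nonneg_def \<mu>_def)
  have \<mu>_int: "has_bochner_integral \<mu> (\<lambda>l. f_levy l (real m / 2 ^ k + 1) - f_levy l (real m / 2 ^ k))
      (\<psi> (real m / 2 ^ k + 1) - \<psi> (real m / 2 ^ k))" if "1 \<le> k" "2 \<le> m" for k m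
  proof -
    define t where "t = real m / 2 ^ k"
    define F where "F l = f_levy l (t + 1) - f_levy l t" for l
    have F[measurable]: "F \<in> borel_measurable borel" unfolding F_def[abs_def] by measurable
    have F'[measurable]: "F \<in> borel_measurable ?N" by (rule measurable_restrict_space1[OF F])
    have W: "(\<lambda>l. unit_increment_weight l * exp l) \<in> borel_measurable borel" by measurable
    then have W'[measurable]: "(\<lambda>l. unit_increment_weight l * exp l) \<in> borel_measurable ?N"
      by (rule measurable_restrict_space1)
    have neg_ln[measurable]: "neg_ln \<in> borel_measurable borel"
      unfolding neg_ln_def[abs_def] by measurable
    have "unit_increment_weight (neg_ln y) * exp (neg_ln y) * F (neg_ln y) = y powr (t - 1)"
      if "0 < y" "y \<le> 1" for y
    proof -
      have "unit_increment_weight (neg_ln y) * exp (neg_ln y) * F (neg_ln y) = exp (neg_ln y) * exp (- (neg_ln y * t))"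
        using f_levy_unit_increment[of "neg_ln y" t] by (simp add: F_def mult_ac)
      then show ?thesis
        using that by (simp add: neg_ln_def powr_def algebra_simps flip: exp_add)
    qed
    then have "has_bochner_integral \<sigma> (\<lambda>y. unit_increment_weight (neg_ln y) * exp (neg_ln y) * F (neg_ln y))
        (\<psi> (t + 1) - \<psi> t)"
      using \<sigma>_int[OF that]
      by (subst has_bochner_integral_cong_AE[of _ _ "\<lambda>y. y powr (t - 1)"])
         (auto intro!: eventually_mono[OF \<sigma>(3)] simp: t_def)
    then have "has_bochner_integral (distr \<sigma> ?N neg_ln) (\<lambda>l. (unit_increment_weight l * exp l) *\<^sub>R F l) (\<psi> (t + 1) - \<psi> t)"
      by (intro has_bochner_integral_distr) auto
    moreover have "AE l in distr \<sigma> ?N neg_ln. 0 \<le> unit_increment_weight l * exp l"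
      by (rule AE_I2) (simp add: space_restrict_space unit_increment_weight_nonneg)
    ultimately have "has_bochner_integral \<mu> F (\<psi> (t + 1) - \<psi> t)"
      unfolding \<mu>_def by (intro has_bochner_integral_density) auto
    then show ?thesis unfolding F_def t_def .
  qed
  have fin: "laplace \<mu> t < \<infinity>" if t: "0 < t" for t
  proof -
    obtain j where "1 / 2 ^ j < t" using reals_power_lt_ex[of t 2] t by (auto simp: power_one_over)
    define k where "k = j + 1"
    \<comment> \<open>This is \<open>1 / 2 ^ j\<close>, written with numerator 2 so that
      \<open>\<mu>_int\<close> applies.\<close>
    define s where "s = real 2 / 2 ^ k"
    have s: "s < t" using \<open>1 / 2 ^ j < t\<close> by (simp add: s_def k_def)
    show ?thesis
      unfolding laplace_finite_iff[OF \<mu>]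
    proof (rule Bochner_Integration.integrable_bound)
      show "integrable \<mu> (\<lambda>l. (1 + 1 / (t - s)) * (f_levy l (s + 1) - f_levy l s))"
        using \<mu>_int[of k 2] unfolding s_def k_def has_bochner_integral_iff
        by (intro integrable_mult_right) auto
      show "AE l in \<mu>. norm (exp (- (l * t))) \<le> norm ((1 + 1 / (t - s)) * (f_levy l (s + 1) - f_levy l s))"
      proof (rule AE_I2)
        fix l assume "l \<in> space \<mu>"
        then show "norm (exp (- (l * t))) \<le> norm ((1 + 1 / (t - s)) * (f_levy l (s + 1) - f_levy l s))"
          unfolding real_norm_def abs_exp_cancel
          by (intro order.trans[OF exp_le_f_levy_unit_increment[OF _ s] abs_ge_self])
             (simp add: space_borel_measure_nonneg[OF \<mu>])
      qed
    qed (rule exp_measurable_borel_measure_nonneg[OF \<mu>])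
  qed
  define \<phi> where "\<phi> t = 0 + (\<integral>l. f_levy l t \<partial>\<mu>)" for t
  have \<phi>: "neg_def_fun \<phi>" "mono_on {0<..} \<phi>"
    unfolding \<phi>_def by (rule neg_def_fun_f_levy_integral[OF \<mu> fin] mono_on_f_levy_integral[OF \<mu> fin]; assumption)+
  have cont: "continuous_on {0<..} \<phi>"
    using DERIV_isCont[OF f_levy_integral_has_derivative[OF \<mu> fin]]
    by (intro continuous_at_imp_continuous_on) (simp add: \<phi>_def[abs_def])
  have unit: "\<psi> (real m / 2 ^ k + 1) - \<psi> (real m / 2 ^ k) = \<phi> (real m / 2 ^ k + 1) - \<phi> (real m / 2 ^ k)"
    if "1 \<le> k" "2 \<le> m" for k m
  proof -
    have "0 < real m / 2 ^ k" using that by simp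
    then have "integrable \<mu> (\<lambda>l. f_levy l (real m / 2 ^ k))" "integrable \<mu> (\<lambda>l. f_levy l (real m / 2 ^ k + 1))"
      by (intro integrable_f_levy[OF \<mu> fin]; simp)+
    then show ?thesis
      using \<mu>_int[OF that] by (simp add: \<phi>_def has_bochner_integral_iff)
  qed
  have "\<psi> t = \<psi> 1 + (\<integral>l. f_levy l t \<partial>\<mu>)" if "0 < t" for t
  proof -
    have "\<psi> t = \<phi> t + (\<psi> 1 - \<phi> 1)"
      by (rule unit_increments_determine_increasing_function[OF \<psi> \<phi> cont unit that])
    then show ?thesis by (simp add: \<phi>_def)
  qed
  then have "levy_representation \<psi> (\<psi> 1) \<mu>"
    unfolding levy_representation_def
    using integrable_f_levy[OF \<mu> fin] by blast
  with \<mu> show ?thesis by (rule that)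
qed

text \<open>The density \<open>exp (- l)\<close> makes the measure finite, and its image under
  \<open>exp (- l)\<close> has the Laplace values at the positive integers as moments. Moments
  determine this image, and both operations can be undone.\<close>

lemma laplace_inj:
  assumes \<mu>: "borel_measure_nonneg \<mu>" and \<nu>: "borel_measure_nonneg \<nu>"
    and fin: "\<And>t. 0 < t \<Longrightarrow> laplace \<mu> t < \<infinity>" and eq: "\<And>t. 0 < t \<Longrightarrow> laplace \<mu> t = laplace \<nu> t"
  shows "\<mu> = \<nu>"
proof -
  let ?N = "restrict_space borel {0::real..}"
  define e :: "real \<Rightarrow> real" where "e l = exp (- l)" for l
  have e[measurable]: "e \<in> borel_measurable borel" unfolding e_def[abs_def] by measurable
  have e_nonneg: "0 \<le> e l" for l by (simp add: e_def)
  define T where "T \<kappa> = distr (density \<kappa> (\<lambda>l. ennreal (e l))) borel e" for \<kappa>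
  have T: "finite_measure (T \<kappa>)" "sets (T \<kappa>) = sets borel" "AE x in T \<kappa>. 0 \<le> x \<and> x \<le> 1"
      "(\<integral>x. x ^ n \<partial>T \<kappa>) = enn2real (laplace \<kappa> (real n + 1))"
      "density (distr (T \<kappa>) ?N neg_ln) (\<lambda>l. ennreal (exp l)) = \<kappa>"
    if \<kappa>: "borel_measure_nonneg \<kappa>" and fin: "laplace \<kappa> 1 < \<infinity>" for \<kappa> n
  proof -
    have e'[measurable]: "e \<in> borel_measurable \<kappa>" by (rule measurable_borel_measure_nonneg[OF \<kappa> e])
    have exp_N[measurable]: "(\<lambda>l. exp l :: real) \<in> borel_measurable ?N"
      by (rule measurable_restrict_space1) measurable
    have exp_\<kappa>[measurable]: "(\<lambda>l. exp l :: real) \<in> borel_measurable \<kappa>"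
      by (rule measurable_borel_measure_nonneg[OF \<kappa>]) measurable
    show "sets (T \<kappa>) = sets borel" by (simp add: T_def)
    show "finite_measure (T \<kappa>)"
    proof (rule finite_measureI)
      have "emeasure (T \<kappa>) (space (T \<kappa>)) = (\<integral>\<^sup>+l. ennreal (e l) * indicator (space \<kappa>) l \<partial>\<kappa>)"
        unfolding T_def by (subst emeasure_distr) (auto simp: emeasure_density)
      also have "\<dots> = laplace \<kappa> 1"
        unfolding laplace_def by (rule nn_integral_cong) (simp add: e_def)
      finally show "emeasure (T \<kappa>) (space (T \<kappa>)) \<noteq> \<infinity>" using fin by simp
    qed
    have "AE x in T \<kappa>. x \<in> {0..1}"
      unfolding T_def
      by (subst AE_distr_iff) (auto intro!: AE_I2 simp: space_borel_measure_nonneg[OF \<kappa>] e_def)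
    then show "AE x in T \<kappa>. 0 \<le> x \<and> x \<le> 1" by simp
    have "(\<integral>x. x ^ n \<partial>T \<kappa>) = (\<integral>l. e l * e l ^ n \<partial>\<kappa>)"
      unfolding T_def by (subst integral_distr) (auto simp: integral_density e_nonneg)
    \<comment> \<open>The density contributes one further factor \<open>e l\<close>, hence the
      argument \<open>n + 1\<close>.\<close>
    also have "\<dots> = (\<integral>l. exp (- (l * (real n + 1))) \<partial>\<kappa>)"
      by (simp add: e_def algebra_simps flip: exp_of_nat_mult exp_add)
    finally show "(\<integral>x. x ^ n \<partial>T \<kappa>) = enn2real (laplace \<kappa> (real n + 1))"
      by (simp add: enn2real_laplace[OF \<kappa>])
    have "distr (T \<kappa>) ?N neg_ln = distr (density \<kappa> (\<lambda>l. ennreal (e l))) ?N (neg_ln \<circ> e)"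
      unfolding T_def by (rule distr_distr) auto
    \<comment> \<open>On the half line \<open>neg_ln\<close> inverts \<open>e\<close>.\<close>
    also have "\<dots> = distr (density \<kappa> (\<lambda>l. ennreal (e l))) ?N (\<lambda>l. l)"
      by (rule distr_cong) (simp_all add: space_borel_measure_nonneg[OF \<kappa>] neg_ln_def e_def)
    also have "\<dots> = density \<kappa> (\<lambda>l. ennreal (e l))"
      by (rule distr_id2) (simp add: sets_borel_measure_nonneg[OF \<kappa>])
    finally have "density (distr (T \<kappa>) ?N neg_ln) (\<lambda>l. ennreal (exp l))
        = density \<kappa> (\<lambda>l. ennreal (e l) * ennreal (exp l))"
      by (simp add: density_density_eq)
    also have "\<dots> = \<kappa>"
      by (simp add: e_def density_1 flip: ennreal_mult exp_add)
    finally show "density (distr (T \<kappa>) ?N neg_ln) (\<lambda>l. ennreal (exp l)) = \<kappa>" .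
  qed
  have \<mu>1: "laplace \<mu> 1 < \<infinity>" and \<nu>1: "laplace \<nu> 1 < \<infinity>" using fin[of 1] eq[of 1] by simp_all
  have "T \<mu> = T \<nu>"
  proof (rule finite_measure_eqI_moments[OF T(1,2,3)[OF \<mu> \<mu>1] T(1,2,3)[OF \<nu> \<nu>1]])
    show "(\<integral>x. x ^ n \<partial>T \<mu>) = (\<integral>x. x ^ n \<partial>T \<nu>)" for n
      unfolding T(4)[OF \<mu> \<mu>1] T(4)[OF \<nu> \<nu>1] by (subst eq) simp_all
  qed
  then show ?thesis using T(5)[OF \<mu> \<mu>1] T(5)[OF \<nu> \<nu>1] by metis
qed

lemma deriv_eq_laplace_unique:
  assumes "borel_measure_nonneg \<mu>" "borel_measure_nonneg \<nu>" "deriv_eq_laplace \<psi> \<mu>" "deriv_eq_laplace \<psi> \<nu>"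
  shows "\<nu> = \<mu>"
proof (rule laplace_inj[OF assms(2,1)])
  fix t :: real assume t: "0 < t"
  have *: "laplace \<mu> t < \<infinity>" "laplace \<nu> t < \<infinity>" using assms t by (auto simp: deriv_eq_laplace_def)
  show "laplace \<nu> t < \<infinity>" by fact
  have "enn2real (laplace \<nu> t) = enn2real (laplace \<mu> t)"
    using assms t unfolding deriv_eq_laplace_def by (blast intro: DERIV_unique)
  then show "laplace \<nu> t = laplace \<mu> t"
    using * by (metis ennreal_enn2real infinity_ennreal_def)
qed

theorem theorem4p7:
  "(\<forall>\<psi> :: real \<Rightarrow> real.
      neg_def_fun \<psi> \<and> mono_on {0<..} \<psi> \<longleftrightarrow>
      (\<exists>\<mu> c. borel_measure_nonneg \<mu> \<and> levy_representation \<psi> c \<mu>)) \<and>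
   (\<forall>(\<psi> :: real \<Rightarrow> real) \<mu> c.
      borel_measure_nonneg \<mu> \<and> levy_representation \<psi> c \<mu> \<longrightarrow>
      c = \<psi> 1 \<and>
      deriv_eq_laplace \<psi> \<mu> \<and>
      (\<forall>\<nu>. borel_measure_nonneg \<nu> \<and> deriv_eq_laplace \<psi> \<nu> \<longrightarrow> \<nu> = \<mu>)) \<and>
   (\<forall>\<mu>. borel_measure_nonneg \<mu> \<longrightarrow>
      ((\<exists>\<psi> c. neg_def_fun \<psi> \<and> mono_on {0<..} \<psi> \<and> levy_representation \<psi> c \<mu>) \<longleftrightarrow>
       (\<forall>t>0. laplace \<mu> t < \<infinity>)))"
proof (intro conjI allI impI)
  fix \<psi> :: "real \<Rightarrow> real"
  show "neg_def_fun \<psi> \<and> mono_on {0<..} \<psi> \<longleftrightarrow>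
      (\<exists>\<mu> c. borel_measure_nonneg \<mu> \<and> levy_representation \<psi> c \<mu>)"
    by (meson levy_representation_imp_neg_def_increasing neg_def_increasing_imp_levy_representation)
next
  fix \<psi> :: "real \<Rightarrow> real" and \<mu> c assume *: "borel_measure_nonneg \<mu> \<and> levy_representation \<psi> c \<mu>"
  \<comment> \<open>At 1 every \<open>f_levy l\<close> vanishes, and so does the integral.\<close>
  then show "c = \<psi> 1" by (simp add: levy_representation_def)
  from * show "deriv_eq_laplace \<psi> \<mu>" by (intro levy_representation_deriv_eq_laplace) auto
  then show "\<nu> = \<mu>" if "borel_measure_nonneg \<nu> \<and> deriv_eq_laplace \<psi> \<nu>" for \<nu>
    using * that deriv_eq_laplace_unique by blast
next
  fix \<mu> assume \<mu>: "borel_measure_nonneg \<mu>"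
  show "(\<exists>\<psi> c. neg_def_fun \<psi> \<and> mono_on {0<..} \<psi> \<and> levy_representation \<psi> c \<mu>) \<longleftrightarrow>
      (\<forall>t>0. laplace \<mu> t < \<infinity>)"
  proof
    assume "\<exists>\<psi> c. neg_def_fun \<psi> \<and> mono_on {0<..} \<psi> \<and> levy_representation \<psi> c \<mu>"
    then show "\<forall>t>0. laplace \<mu> t < \<infinity>"
      using laplace_finite_if_levy_representation[OF \<mu>] by blast
  next
    assume "\<forall>t>0. laplace \<mu> t < \<infinity>"
    then have fin: "\<And>t. 0 < t \<Longrightarrow> laplace \<mu> t < \<infinity>" by blast
    define \<psi> where "\<psi> t = 0 + (\<integral>l. f_levy l t \<partial>\<mu>)" for t
    have "levy_representation \<psi> 0 \<mu>"
      using integrable_f_levy[OF \<mu> fin] by (simp add: levy_representation_def \<psi>_def)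
    then show "\<exists>\<psi> c. neg_def_fun \<psi> \<and> mono_on {0<..} \<psi> \<and> levy_representation \<psi> c \<mu>"
      using levy_representation_imp_neg_def_increasing[OF \<mu>] by blast
  qed
qed

end
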